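(* Let $n\geq 1$, and let $H$, $K$, $H^*$, $K^*$, $X^2$ be the operators on Schwartz-class fields given in the context. Then the following hold: (1) $\operatorname{im}(H)+\operatorname{im}(K)\subset\ker(X^2)$. (2) $\ker(H^* )\cap\ker(K^* )\cap\ker(X^2)=0$.
   Context: $E^1(n)=\mathbb{R}^n\otimes_{\mathrm s}\mathbb{R}^n$ is the space of symmetric $2$-tensors on $\mathbb{R}^n$. $E^2(n)=(\mathbb{R}^n\otimes_{\mathrm s}\mathbb{R}^n)^{\otimes_{\mathrm s}2}$ is the space of elastic $2$-tensors, i.e. tensors $(a_{ijkl})$, $1\le i,j,k,l\le n$, with $a_{ijkl}=a_{jikl}=a_{klij}$. $\mathscr{S}(\mathbb{R}^n;E)$ denotes Schwartz functions with values in the finite-dimensional vector space $E$. For $v\in\mathbb{S}^{n-1}$ let $Q(v)=\mathbb{R}v\cup v^\perp\subset\mathbb{R}^n$. For $f\in\mathscr{S}(\mathbb{R}^n;E^2(n))$, $x\in\mathbb{R}^n$, $v\in\mathbb{S}^{n-1}$, $q\in Q(v)$, $$X^2_{v,q}f(x)=\int_{\mathbb{R}}\sum_{i,j,k,l}f_{ijkl}(x+tv)\,v_iq_jv_kq_l\,dt,$$ and $\ker(X^2)$ is the set of $f$ with $X^2_{v,q}f=0$ for all $v\in\mathbb{S}^{n-1}$ and all $q\in Q(v)$. The operators (all between Schwartz classes) are: $H:\mathscr{S}(\mathbb{R}^n;E^1(n))\to\mathscr{S}(\mathbb{R}^n;E^2(n))$, $(Hh)_{ijkl}=\tfrac12(\partial_i\partial_jh_{kl}+\partial_k\partial_lh_{ij})$;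 $K:\mathscr{S}(\mathbb{R}^n;\mathbb{R}^n)\to\mathscr{S}(\mathbb{R}^n;E^2(n))$, $(KW)_{ijkl}=\tfrac14(\partial_iW_j+\partial_jW_i)\delta_{kl}+\tfrac14(\partial_kW_l+\partial_lW_k)\delta_{ij}$; and their formal $L^2$ adjoints $H^*:\mathscr{S}(\mathbb{R}^n;E^2(n))\to\mathscr{S}(\mathbb{R}^n;E^1(n))$, $(H^*f)_{ij}=\sum_{k,l}\partial_k\partial_lf_{ijkl}$; $K^*:\mathscr{S}(\mathbb{R}^n;E^2(n))\to\mathscr{S}(\mathbb{R}^n;\mathbb{R}^n)$, $(K^*f)_i=-\sum_{j,k}\partial_jf_{ijkk}$. *)

theory Defs
  imports "HOL-Analysis.Analysis"
begin

definition partial_deriv :: "'n::finite \<Rightarrow> (real^'n \<Rightarrow> 'e::real_normed_vector) \<Rightarrow> real^'n \<Rightarrow> 'e"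
  where "partial_deriv i f x = frechet_derivative f (at x) (axis i 1)"

primrec iter_partial :: "'n::finite list \<Rightarrow> (real^'n \<Rightarrow> 'e::real_normed_vector) \<Rightarrow> real^'n \<Rightarrow> 'e"
  where
    "iter_partial [] f = f"
  | "iter_partial (i # is) f = partial_deriv i (iter_partial is f)"

text \<open>Schwartz functions with values in the linear subspace \<open>E\<close> of the type \<open>'e\<close>. Differentiability
  of all iterated partial derivatives (in any order) is smoothness, and it makes the total operator
  \<open>partial_deriv\<close> meaningful wherever it is applied to such a function.\<close>

definition schwartz :: "'e::real_normed_vector set \<Rightarrow> (real^'n::finite \<Rightarrow> 'e) set"
  where "schwartz E = {f. range f \<subseteq> E \<and>
    (\<forall>is x. iter_partial is f differentiable (at x)) \<and>
    (\<forall>is (m::nat). bounded (range (\<lambda>x. norm x ^ m *\<^sub>R iter_partial is f x)))}"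

definition sym_tensors :: "(real^'n^'n) set"
  where "sym_tensors = {a. \<forall>i j. a $ i $ j = a $ j $ i}"

definition elastic_tensors :: "(real^'n^'n^'n^'n) set"
  where "elastic_tensors = {a. \<forall>i j k l.
    a $ i $ j $ k $ l = a $ j $ i $ k $ l \<and> a $ i $ j $ k $ l = a $ k $ l $ i $ j}"

definition kdelta :: "'n \<Rightarrow> 'n \<Rightarrow> real"
  where "kdelta i j = (if i = j then 1 else 0)"

definition Q_set :: "real^'n \<Rightarrow> (real^'n::finite) set"
  where "Q_set v = span {v} \<union> {v}\<^sup>\<bottom>"

text \<open>For Schwartz \<open>f\<close> and \<open>v \<noteq> 0\<close> the integrand is Lebesgue integrable, so the default value of
  the Bochner integral plays no role.\<close>

definition X2 :: "(real^'n::finite \<Rightarrow> real^'n^'n^'n^'n) \<Rightarrow> real^'n \<Rightarrow> real^'n \<Rightarrow> real^'n \<Rightarrow> real"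
  where "X2 f v q x =
    (\<integral>t. (\<Sum>i\<in>UNIV. \<Sum>j\<in>UNIV. \<Sum>k\<in>UNIV. \<Sum>l\<in>UNIV.
        f (x + t *\<^sub>R v) $ i $ j $ k $ l * v $ i * q $ j * v $ k * q $ l) \<partial>lborel)"

definition ker_X2 :: "(real^'n::finite \<Rightarrow> real^'n^'n^'n^'n) set"
  where "ker_X2 = {f \<in> schwartz elastic_tensors.
    \<forall>v\<in>sphere 0 1. \<forall>q\<in>Q_set v. \<forall>x. X2 f v q x = 0}"

text \<open>The four operators are total on functions; restriction to the Schwartz classes takes place in
  the images and kernels below.\<close>

definition H_op :: "(real^'n::finite \<Rightarrow> real^'n^'n) \<Rightarrow> real^'n \<Rightarrow> real^'n^'n^'n^'n"
  where "H_op h x = (\<chi> i j k l.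
    1/2 * (partial_deriv i (partial_deriv j (\<lambda>y. h y $ k $ l)) x
         + partial_deriv k (partial_deriv l (\<lambda>y. h y $ i $ j)) x))"

definition K_op :: "(real^'n::finite \<Rightarrow> real^'n) \<Rightarrow> real^'n \<Rightarrow> real^'n^'n^'n^'n"
  where "K_op W x = (\<chi> i j k l.
    1/4 * (partial_deriv i (\<lambda>y. W y $ j) x + partial_deriv j (\<lambda>y. W y $ i) x) * kdelta k l
  + 1/4 * (partial_deriv k (\<lambda>y. W y $ l) x + partial_deriv l (\<lambda>y. W y $ k) x) * kdelta i j)"

definition H_adj :: "(real^'n::finite \<Rightarrow> real^'n^'n^'n^'n) \<Rightarrow> real^'n \<Rightarrow> real^'n^'n"
  where "H_adj f x = (\<chi> i j. \<Sum>k\<in>UNIV. \<Sum>l\<in>UNIV.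
    partial_deriv k (partial_deriv l (\<lambda>y. f y $ i $ j $ k $ l)) x)"

definition K_adj :: "(real^'n::finite \<Rightarrow> real^'n^'n^'n^'n) \<Rightarrow> real^'n \<Rightarrow> real^'n"
  where "K_adj f x = (\<chi> i. - (\<Sum>j\<in>UNIV. \<Sum>k\<in>UNIV.
    partial_deriv j (\<lambda>y. f y $ i $ j $ k $ k) x))"

definition im_H :: "(real^'n::finite \<Rightarrow> real^'n^'n^'n^'n) set"
  where "im_H = H_op ` schwartz sym_tensors"

definition im_K :: "(real^'n::finite \<Rightarrow> real^'n^'n^'n^'n) set"
  where "im_K = K_op ` schwartz UNIV"

definition ker_H_adj :: "(real^'n::finite \<Rightarrow> real^'n^'n^'n^'n) set"
  where "ker_H_adj = {f \<in> schwartz elastic_tensors. H_adj f = (\<lambda>x. 0)}"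

definition ker_K_adj :: "(real^'n::finite \<Rightarrow> real^'n^'n^'n^'n) set"
  where "ker_K_adj = {f \<in> schwartz elastic_tensors. K_adj f = (\<lambda>x. 0)}"

end

theory Submission
  imports Defs "HOL-Probability.Probability"
begin

text \<open>
  (1) Contracting an element of the image of \<open>H\<close> or \<open>K\<close> with \<open>v, q, v, q\<close> gives the derivative in direction
  \<open>v\<close> of a Schwartz function (the contraction of \<open>K W\<close> vanishes if \<open>q\<close> is orthogonal to \<open>v\<close>), so its
  line integrals vanish.

  (2) By the Fourier slice theorem, the Fourier transform \<open>A\<close> of \<open>f\<close> at \<open>\<xi> \<noteq> 0\<close> satisfies \<open>A v q v q = 0\<close>
  for \<open>v\<close> orthogonal to \<open>\<xi>\<close> and \<open>q\<close> parallel or orthogonal to \<open>v\<close>, while the adjoint equations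
  say \<open>A a b \<xi> \<xi> = 0\<close> and \<open>\<Sum>k. A a \<xi> k k = 0\<close>. Decompose each argument along \<open>\<xi>\<close> and its complement. The
  components with at least two entries \<open>\<xi>\<close> vanish at once. Those with one entry \<open>\<xi>\<close> have the form
  \<open>A v w u \<xi> = (v \<bullet> w) * c u\<close>, and the trace condition gives \<open>c = 0\<close>. Those with none vanish by
  polarisation. Fourier uniqueness then yields \<open>f = 0\<close>.
\<close>

section \<open>Linear algebra of elastic tensors\<close>

text \<open>In the application \<open>A\<close> contracts the cosine transforms of the components of
  \<open>f\<close> at a nonzero frequency, and \<open>e\<close> is that frequency normalised. Then
  \<open>div2\<close> and \<open>divtr\<close> are the two adjoint equations, while
  \<open>diag\<close> and \<open>orth\<close> express the vanishing line integrals for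
  \<open>q\<close> parallel and orthogonal to \<open>v\<close>.\<close>

lemma elastic_form_eq_0:
  fixes A :: "'a::euclidean_space \<Rightarrow> 'a \<Rightarrow> 'a \<Rightarrow> 'a \<Rightarrow> real"
  assumes lin: "\<And>b c d. linear (\<lambda>a. A a b c d)"
    and flip: "\<And>a b c d. A a b c d = A b a c d"
    and swap: "\<And>a b c d. A a b c d = A c d a b"
    and e: "norm e = 1"
    and div2: "\<And>a b. A a b e e = 0"
    and divtr: "\<And>a. (\<Sum>b\<in>Basis. A a e b b) = 0"
    and diag: "\<And>v. v \<bullet> e = 0 \<Longrightarrow> A v v v v = 0"
    and orth: "\<And>v q. v \<bullet> e = 0 \<Longrightarrow> v \<bullet> q = 0 \<Longrightarrow> A v q v q = 0"
  shows "A a b c d = 0"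
proof -
  have a1: "A (x + y) b c d = A x b c d + A y b c d" for x y b c d
    using lin by (rule linear_add)
  have a2: "A b (x + y) c d = A b x c d + A b y c d" for x y b c d
    using a1[of x y b c d] flip by metis
  have a3: "A c d (x + y) b = A c d x b + A c d y b" for x y b c d
    using a1[of x y b c d] swap by metis
  have a4: "A c d b (x + y) = A c d b x + A c d b y" for x y b c d
    using a2[of b x y c d] swap by metis
  note add = a1 a2 a3 a4
  have s1: "A (r *\<^sub>R x) b c d = r * A x b c d" for r x b c d
    by (metis linear_scale[OF lin] real_scaleR_def)
  have s2: "A b (r *\<^sub>R x) c d = r * A b x c d" for r x b c d
    using s1[of r x b c d] flip by metis
  have s3: "A c d (r *\<^sub>R x) b = r * A c d x b" for r x b c d
    using s1[of r x b c d] swap by metis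
  have s4: "A c d b (r *\<^sub>R x) = r * A c d b x" for r x b c d
    using s2[of b r x c d] swap by metis
  note scale = s1 s2 s3 s4
  have flip': "A a b c d = A a b d c" for a b c d
    using flip swap by metis
  have ee: "e \<bullet> e = 1" using e by (simp add: norm_eq_1)
  txt \<open>On the complement of \<open>e\<close>, testing \<open>orth\<close> with \<open>q + e\<close> isolates the components with one or two
    entries \<open>e\<close>.\<close>
  have pe: "A v e w e = 0" if "v \<bullet> e = 0" "w \<bullet> e = 0" for v w
  proof -
    have "A (v + w) e (v + w) e = 0" "A v e v e = 0" "A w e w e = 0"
      using orth that by (auto simp: inner_simps)
    then have "A v e w e + A w e v e = 0" by (simp add: add)
    then show ?thesis using swap[of v e w e] by simp
  qed
  have ortho3: "A v w v e = 0" if "v \<bullet> e = 0" "w \<bullet> e = 0" "v \<bullet> w = 0" for v w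
  proof -
    have "A v (w + e) v (w + e) = 0" "A v w v w = 0"
      using orth[of v "w+e"] orth[of v w] that by (auto simp: inner_simps)
    then show ?thesis using pe[of v v] swap[of v e v w] that by (simp add: add)
  qed
  \<comment> \<open>Applying \<open>ortho3\<close> to a frame rotated by 45 degrees compares the
    diagonal entries in the directions \<open>y\<close> and \<open>u\<close>.\<close>
  have key: "A y y u e = (norm y)\<^sup>2 * A u u u e"
    if "u \<bullet> e = 0" "y \<bullet> e = 0" "norm u = 1" "u \<bullet> y = 0" for u y
  proof (cases "y = 0")
    case True
    then show ?thesis using scale(1)[of 0 0] by simp
  next
    case False
    define r where "r = norm y"
    have r: "r \<noteq> 0" "y \<bullet> y = r\<^sup>2" using False by (auto simp: r_def power2_norm_eq_inner)
    have uu: "u \<bullet> u = 1" using that by (simp add: norm_eq_1)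
    txt \<open>As \<open>\<parallel>r *\<^sub>R u\<parallel> = \<parallel>y\<parallel>\<close>, the vectors \<open>r *\<^sub>R u + y\<close> and \<open>r *\<^sub>R u - y\<close> are orthogonal.\<close>
    have o: "(r *\<^sub>R u + y) \<bullet> (r *\<^sub>R u + (-1) *\<^sub>R y) = 0"
      using uu r that by (simp add: inner_simps inner_commute power2_eq_square)
    have 1: "A (r *\<^sub>R u + y) (r *\<^sub>R u + (-1) *\<^sub>R y) (r *\<^sub>R u + y) e = 0"
      by (rule ortho3) (use o that in \<open>auto simp: inner_simps\<close>)
    have 2: "A (r *\<^sub>R u + (-1) *\<^sub>R y) (r *\<^sub>R u + y) (r *\<^sub>R u + (-1) *\<^sub>R y) e = 0"
      by (rule ortho3) (use o that in \<open>auto simp: inner_simps inner_commute\<close>)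
    have 3: "r * (r * A u u y e) + r * (r * (r * A u u u e)) = A y y y e + r * A y y u e"
      using 1 unfolding add scale by (simp add: flip[of y u] algebra_simps)
    have 4: "A y y y e + r * (r * (r * A u u u e)) = r * A y y u e + r * (r * A u u y e)"
      using 2 unfolding add scale by (simp add: flip[of y u] algebra_simps)
    \<comment> \<open>In the sum of the two relations the terms with \<open>A u u y e\<close> and
      \<open>A y y y e\<close> cancel.\<close>
    have "r * (r\<^sup>2 * A u u u e) = r * A y y u e"
      using 3 4 unfolding power2_eq_square mult.assoc by linarith
    then show ?thesis using r by (simp add: r_def)
  qed
  \<comment> \<open>Splitting \<open>w\<close> along \<open>u\<close> and its complement reduces
    this to \<open>key\<close>; the mixed terms vanish by \<open>ortho3\<close>.\<close>
  have key2: "A w w u e = (norm w)\<^sup>2 * A u u u e"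
    if "u \<bullet> e = 0" "w \<bullet> e = 0" "norm u = 1" for u w
  proof -
    define c where "c = w \<bullet> u"
    define y where "y = w - c *\<^sub>R u"
    have uu: "u \<bullet> u = 1" using that by (simp add: norm_eq_1)
    have w: "w = c *\<^sub>R u + y" by (simp add: y_def)
    have y: "y \<bullet> e = 0" "u \<bullet> y = 0"
      using that uu by (auto simp: y_def c_def inner_simps inner_commute)
    have "(norm w)\<^sup>2 = c\<^sup>2 + (norm y)\<^sup>2"
      unfolding w power2_norm_eq_inner using y uu
      by (simp add: inner_simps inner_commute power2_eq_square)
    moreover have "A w w u e = c\<^sup>2 * A u u u e + A y y u e"
      unfolding w add scale using ortho3[of u y] y that flip[of y u u e]
      by (simp add: power2_eq_square)
    ultimately show ?thesis using key[of u y] y that by (simp add: algebra_simps)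
  qed
  \<comment> \<open>Once the entries \<open>e\<close> are removed, \<open>key2\<close> evaluates
    each term of the trace \<open>divtr\<close>. What remains is \<open>A u u u e\<close> times the
    sum of the squared norms of the projections \<open>p b\<close>, and this sum is at least the
    squared norm of \<open>u\<close>, hence positive.\<close>
  have T0: "A u u u e = 0" if u: "u \<bullet> e = 0" "norm u = 1" for u
  proof -
    define p where "p b = b - (b \<bullet> e) *\<^sub>R e" for b
    have p: "p b \<bullet> e = 0" "p b \<bullet> u = b \<bullet> u" "b = p b + (b \<bullet> e) *\<^sub>R e" for b
      using u ee by (auto simp: p_def inner_simps inner_commute)
    have "A u e b b = (norm (p b))\<^sup>2 * A u u u e" for b
    proof -
      have "A u e b b = A b b u e" by (rule swap)
      also have "\<dots> = A (p b + (b \<bullet> e) *\<^sub>R e) (p b + (b \<bullet> e) *\<^sub>R e) u e"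
        using p(3)[of b] by simp
      also have "\<dots> = A (p b) (p b) u e"
        unfolding add scale using pe[of "p b" u] p u flip[of e "p b" u e]
          div2[of u e] swap[of e e u e] by simp
      finally show ?thesis using key2[of u "p b"] p u by simp
    qed
    then have "(\<Sum>b\<in>Basis. (norm (p b))\<^sup>2) * A u u u e = 0"
      using divtr[of u] by (simp add: sum_distrib_right)
    moreover have "(\<Sum>b\<in>Basis. (norm (p b))\<^sup>2) \<ge> (\<Sum>b\<in>Basis. (b \<bullet> u)\<^sup>2)"
    proof (rule sum_mono)
      fix b
      have "\<bar>p b \<bullet> u\<bar> \<le> norm (p b)" using Cauchy_Schwarz_ineq2[of "p b" u] u by simp
      then show "(b \<bullet> u)\<^sup>2 \<le> (norm (p b))\<^sup>2" using power_mono[of "\<bar>b \<bullet> u\<bar>" "norm (p b)" 2] p(2) by simp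
    qed
    moreover have "(\<Sum>b\<in>Basis. (b \<bullet> u)\<^sup>2) = 1"
      using euclidean_inner[of u u] u by (simp add: norm_eq_1 power2_eq_square inner_commute)
    ultimately show ?thesis by (smt (verit) mult_eq_0_iff)
  qed
  have T1: "A w w u e = 0" if "u \<bullet> e = 0" "w \<bullet> e = 0" for u w
  proof (cases "u = 0")
    case True
    then show ?thesis using scale(3)[of _ _ 0 0] by simp
  next
    case False
    have "A w w (inverse (norm u) *\<^sub>R u) e = 0"
      using key2[of "inverse (norm u) *\<^sub>R u" w] T0[of "inverse (norm u) *\<^sub>R u"] that False by simp
    then show ?thesis using False scale by simp
  qed
  have T2: "A v w u e = 0" if "u \<bullet> e = 0" "w \<bullet> e = 0" "v \<bullet> e = 0" for u v w
    using T1[of u "v + w"] T1[of u v] T1[of u w] flip[of w v u e] that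
    by (simp add: add inner_simps)
  \<comment> \<open>Expanding \<open>diag\<close> at \<open>v + r *\<^sub>R q\<close> gives a
    polynomial in \<open>r\<close> that vanishes identically. Its constant and quartic coefficients
    are 0 by \<open>diag\<close>, so the values at 1, -1 and 2 determine the other three.\<close>
  have quart: "A v v v q = 0 \<and> A v v q q + 2 * A v q v q = 0"
    if "v \<bullet> e = 0" "q \<bullet> e = 0" for v q
  proof -
    have sy: "A v q v v = A v v v q" "A q v v v = A v v v q" "A v v q v = A v v v q"
      "A q q v q = A v q q q" "A q q q v = A v q q q" "A q v q q = A v q q q"
      "A q q v v = A v v q q" "A q v q v = A v q v q" "A v q q v = A v q v q"
      "A q v v q = A v q v q"
      using flip swap by metis+
    have 0: "A (v + r *\<^sub>R q) (v + r *\<^sub>R q) (v + r *\<^sub>R q) (v + r *\<^sub>R q) = 0" for r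
      by (rule diag) (use that in \<open>simp add: inner_simps\<close>)
    have "A v v v v = 0" "A q q q q = 0" using diag that by auto
    then have "4 * r * A v v v q + r * r * (2 * A v v q q + 4 * A v q v q)
        + 4 * r * r * r * A v q q q = 0" for r
      using 0[of r] unfolding add scale by (simp add: sy algebra_simps)
    from this[of 1] this[of "-1"] this[of 2] show ?thesis by simp
  qed
  have Q0: "A v q v q = 0" if "v \<bullet> e = 0" "q \<bullet> e = 0" for v q
  proof -
    \<comment> \<open>For \<open>v = 0\<close> division by zero yields \<open>c = 0\<close>, hence
      \<open>y = q\<close>, and \<open>y\<close> is still orthogonal to \<open>v\<close>.\<close>
    define c where "c = (v \<bullet> q) / (v \<bullet> v)"
    define y where "y = q - c *\<^sub>R v"
    have q: "q = c *\<^sub>R v + y" by (simp add: y_def)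
    have "v \<bullet> y = 0" by (cases "v = 0") (auto simp: y_def c_def inner_simps)
    then have "A v y v y = 0" using orth that by auto
    moreover have "A v v v y = 0" using quart[of v y] that by (simp add: y_def inner_simps)
    ultimately show ?thesis
      unfolding q add scale using diag that swap[of v y v v] by simp
  qed
  have Q1: "A v v q q = 0" if "v \<bullet> e = 0" "q \<bullet> e = 0" for v q
    using quart Q0 that by fastforce
  have Q2: "A v w q q = 0" if "v \<bullet> e = 0" "w \<bullet> e = 0" "q \<bullet> e = 0" for v w q
    using Q1[of "v + w" q] Q1[of v q] Q1[of w q] flip[of w v q q] that
    by (simp add: add inner_simps)
  have Q3: "A v w q r = 0" if "v \<bullet> e = 0" "w \<bullet> e = 0" "q \<bullet> e = 0" "r \<bullet> e = 0" for v w q r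
    using Q2[of v w "q + r"] Q2[of v w q] Q2[of v w r] flip'[of v w r q] that
    by (simp add: add inner_simps)
  define p where "p b = b - (b \<bullet> e) *\<^sub>R e" for b
  have p: "p b \<bullet> e = 0" "b = p b + (b \<bullet> e) *\<^sub>R e" for b
    using ee by (auto simp: p_def inner_simps inner_commute)
  \<comment> \<open>Only the last two arguments are split along \<open>e\<close>. Using this on each
    pair of arguments, with \<open>swap\<close> in between, handles all four.\<close>
  have dec: "A x y c d = 0" if "\<And>r s. r \<bullet> e = 0 \<Longrightarrow> s \<bullet> e = 0 \<Longrightarrow> A x y r s = 0"
    "\<And>r. r \<bullet> e = 0 \<Longrightarrow> A x y r e = 0" for x y c d
  proof -
    have "A x y c d = A x y (p c + (c \<bullet> e) *\<^sub>R e) (p d + (d \<bullet> e) *\<^sub>R e)"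
      using p(2)[of c] p(2)[of d] by simp
    also have "\<dots> = 0"
      unfolding add scale using that p div2 flip'[of x y e "p d"] by simp
    finally show ?thesis .
  qed
  have rs: "A r s c d = 0" if "r \<bullet> e = 0" "s \<bullet> e = 0" for r s c d
    by (rule dec) (use Q3 T2 that in blast)+
  have re: "A r e c d = 0" if "r \<bullet> e = 0" for r c d
  proof (rule dec)
    show "A r e r' s' = 0" if "r' \<bullet> e = 0" "s' \<bullet> e = 0" for r' s'
      using rs[of r' s' r e] that swap[of r e r' s'] by simp
    show "A r e r' e = 0" if "r' \<bullet> e = 0" for r'
      using pe that \<open>r \<bullet> e = 0\<close> by blast
  qed
  have "A c d a b = 0"
  proof (rule dec)
    show "A c d r s = 0" if "r \<bullet> e = 0" "s \<bullet> e = 0" for r s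
      using rs[of r s c d] that swap[of c d r s] by simp
    show "A c d r e = 0" if "r \<bullet> e = 0" for r
      using re[of r c d] that swap[of c d r e] by simp
  qed
  then show ?thesis using swap[of a b c d] by simp
qed

section \<open>Schwartz functions\<close>

lemma partial_deriv_eq:
  assumes "(f has_derivative f') (at x)"
  shows "partial_deriv i f x = f' (axis i 1)"
  using frechet_derivative_at[OF assms] by (simp add: partial_deriv_def)

lemma differentiable_has_derivative_partials:
  assumes "f differentiable (at x)"
  shows "(f has_derivative (\<lambda>h. \<Sum>i\<in>UNIV. (h $ i) *\<^sub>R partial_deriv i f x)) (at x)"
proof -
  obtain f' where f': "(f has_derivative f') (at x)"
    using assms by (auto simp: differentiable_def)
  interpret f': bounded_linear f' using f' by (rule has_derivative_bounded_linear)
  have "f' = (\<lambda>h. \<Sum>i\<in>UNIV. (h $ i) *\<^sub>R partial_deriv i f x)"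
  proof
    fix h :: "real^'a"
    have "f' h = f' (\<Sum>i\<in>UNIV. (h $ i) *\<^sub>R axis i 1)"
      using basis_expansion[of h] by (simp add: scalar_mult_eq_scaleR)
    then show "f' h = (\<Sum>i\<in>UNIV. (h $ i) *\<^sub>R partial_deriv i f x)"
      by (simp add: f'.sum f'.scaleR partial_deriv_eq[OF f'])
  qed
  with f' show ?thesis by simp
qed

lemma has_vector_derivative_line:
  assumes "f differentiable (at (x + t *\<^sub>R v))"
  shows "((\<lambda>t. f (x + t *\<^sub>R v)) has_vector_derivative
    (\<Sum>i\<in>UNIV. (v $ i) *\<^sub>R partial_deriv i f (x + t *\<^sub>R v))) (at t)"
proof -
  have "((\<lambda>t. x + t *\<^sub>R v) has_derivative (\<lambda>h. h *\<^sub>R v)) (at t)"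
    by (auto intro!: derivative_eq_intros)
  from diff_chain_at[OF this differentiable_has_derivative_partials[OF assms]]
  show ?thesis
    by (simp add: has_vector_derivative_def o_def scaleR_sum_right)
qed

lemma partial_deriv_bounded_linear:
  assumes "bounded_linear L" "f differentiable (at x)"
  shows "partial_deriv i (\<lambda>x. L (f x)) x = L (partial_deriv i f x)"
proof -
  have "((\<lambda>x. L (f x)) has_derivative (\<lambda>h. L (frechet_derivative f (at x) h))) (at x)"
    using assms by (auto intro: bounded_linear.has_derivative simp: frechet_derivative_works)
  from partial_deriv_eq[OF this] show ?thesis by (simp add: partial_deriv_def)
qed

lemma partial_deriv_add:
  assumes "f differentiable (at x)" "g differentiable (at x)"
  shows "partial_deriv i (\<lambda>x. f x + g x) x = partial_deriv i f x + partial_deriv i g x"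
  using has_derivative_add[OF assms[unfolded frechet_derivative_works]]
  by (simp add: partial_deriv_eq) (simp add: partial_deriv_def)

section \<open>Closure properties of the Schwartz class\<close>

lemma iter_partial_append: "iter_partial (is @ js) f = iter_partial is (iter_partial js f)"
  by (induction "is") simp_all

lemma schwartz_differentiable: "f \<in> schwartz E \<Longrightarrow> f differentiable (at x)"
  unfolding schwartz_def mem_Collect_eq by (metis iter_partial.simps(1))

text \<open>The closure lemmas produce members of \<open>schwartz UNIV\<close>; with this
  equivalence the constraint on the values is checked pointwise afterwards.\<close>

lemma schwartz_iff: "f \<in> schwartz E \<longleftrightarrow> f \<in> schwartz UNIV \<and> range f \<subseteq> E"
  by (auto simp: schwartz_def)

lemma schwartz_partial_deriv:
  assumes "f \<in> schwartz E"
  shows "partial_deriv i f \<in> schwartz UNIV"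
  using assms iter_partial_append[of _ "[i]" f] unfolding schwartz_def
  by auto metis+

lemma iter_partial_bounded_linear:
  assumes "bounded_linear L" "f \<in> schwartz E"
  shows "iter_partial is (\<lambda>x. L (f x)) = (\<lambda>x. L (iter_partial is f x))"
proof (induction "is")
  case (Cons i "is")
  have "iter_partial is f differentiable at x" for x
    using assms by (auto simp: schwartz_def)
  then show ?case
    by (auto simp: Cons partial_deriv_bounded_linear[OF assms(1)])
qed simp

lemma schwartz_bounded_linear:
  assumes "bounded_linear L" "f \<in> schwartz E"
  shows "(\<lambda>x. L (f x)) \<in> schwartz UNIV"
proof -
  have "iter_partial is (\<lambda>x. L (f x)) differentiable (at x)" for "is" x
    unfolding iter_partial_bounded_linear[OF assms]
    using assms differentiable_compose[of L "iter_partial is f" x]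
    by (auto simp: schwartz_def bounded_linear_imp_differentiable)
  moreover have "bounded (range (\<lambda>x. norm x ^ m *\<^sub>R iter_partial is (\<lambda>x. L (f x)) x))" for "is" m
  proof -
    have "bounded (L ` range (\<lambda>x. norm x ^ m *\<^sub>R iter_partial is f x))"
      by (rule bounded_linear_image) (use assms in \<open>auto simp: schwartz_def\<close>)
    then show ?thesis
      unfolding iter_partial_bounded_linear[OF assms] image_image
      by (simp add: linear_scale[OF bounded_linear.linear[OF assms(1)]])
  qed
  ultimately show ?thesis by (simp add: schwartz_def)
qed

lemma iter_partial_add:
  assumes "f \<in> schwartz E" "g \<in> schwartz F"
  shows "iter_partial is (\<lambda>x. f x + g x) = (\<lambda>x. iter_partial is f x + iter_partial is g x)"
proof (induction "is")
  case (Cons i "is")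
  have "iter_partial is f differentiable at x" "iter_partial is g differentiable at x" for x
    using assms by (auto simp: schwartz_def)
  then show ?case
    by (auto simp: Cons partial_deriv_add)
qed simp

lemma schwartz_add:
  assumes "f \<in> schwartz E" "g \<in> schwartz F"
  shows "(\<lambda>x. f x + g x) \<in> schwartz UNIV"
proof -
  have "iter_partial is (\<lambda>x. f x + g x) differentiable (at x)" for "is" x
    unfolding iter_partial_add[OF assms]
    using assms by (auto simp: schwartz_def)
  moreover have "bounded (range (\<lambda>x. norm x ^ m *\<^sub>R iter_partial is (\<lambda>x. f x + g x) x))" for "is" m
    unfolding iter_partial_add[OF assms] scaleR_add_right
    using assms by (intro bounded_plus_comp) (auto simp: schwartz_def)
  ultimately show ?thesis by (simp add: schwartz_def)
qed

lemma partial_deriv_zero [simp]: "partial_deriv i (\<lambda>x. 0) = (\<lambda>x. 0)"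
  by (rule ext, subst partial_deriv_eq[OF has_derivative_const]) simp

lemma iter_partial_zero [simp]: "iter_partial is (\<lambda>x. 0) = (\<lambda>x. 0)"
  by (induction "is") auto

lemma zero_in_schwartz: "(\<lambda>x. 0) \<in> schwartz E \<longleftrightarrow> 0 \<in> E"
  by (auto simp: schwartz_def)

lemma schwartz_sum:
  assumes "\<And>i. i \<in> I \<Longrightarrow> f i \<in> schwartz UNIV"
  shows "(\<lambda>x. \<Sum>i\<in>I. f i x) \<in> schwartz UNIV"
  using assms
  by (induction I rule: infinite_finite_induct)
    (auto simp: zero_in_schwartz intro: schwartz_add[where E = UNIV and F = UNIV])

lemma schwartz_scaleR:
  "f \<in> schwartz UNIV \<Longrightarrow> (\<lambda>x. c *\<^sub>R f x) \<in> schwartz UNIV"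
  by (rule schwartz_bounded_linear[OF bounded_linear_scaleR_right])

lemma schwartz_mult_left:
  fixes f :: "real^'n \<Rightarrow> real"
  shows "f \<in> schwartz UNIV \<Longrightarrow> (\<lambda>x. c * f x) \<in> schwartz UNIV"
  using schwartz_scaleR[of f c] by simp

lemma schwartz_mult_right:
  fixes f :: "real^'n \<Rightarrow> real"
  shows "f \<in> schwartz UNIV \<Longrightarrow> (\<lambda>x. f x * c) \<in> schwartz UNIV"
  using schwartz_scaleR[of f c] by (simp add: mult.commute)

lemma schwartz_nth:
  fixes f :: "real^'n \<Rightarrow> 'e::real_normed_vector^'m"
  shows "f \<in> schwartz E \<Longrightarrow> (\<lambda>x. f x $ i) \<in> schwartz UNIV"
  by (rule schwartz_bounded_linear[OF bounded_linear_vec_nth])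

text \<open>A vector field is the finite sum of its components embedded by \<open>axis i\<close>,
  and these embeddings are bounded linear.\<close>

lemma schwartz_vec:
  fixes f :: "real^'n \<Rightarrow> 'e::real_normed_vector^'m"
  assumes "\<And>i. (\<lambda>x. f x $ i) \<in> schwartz UNIV"
  shows "f \<in> schwartz UNIV"
proof -
  have "norm (axis i y :: 'e^'m) = norm y" for i y
    by (simp add: norm_vec_def L2_set_def axis_def if_distrib[of norm] if_distrib[of "\<lambda>r. r\<^sup>2"]
        cong: if_cong)
  then have bl: "bounded_linear (axis i :: 'e \<Rightarrow> 'e^'m)" for i
    by (intro bounded_linear_intro[of _ 1]) (auto simp: axis_def vec_eq_iff)
  have "f x = (\<Sum>i\<in>UNIV. axis i (f x $ i))" for x
    by (simp add: vec_eq_iff axis_def if_distrib[of "\<lambda>v. v $ _"] cong: if_cong)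
  moreover have "(\<lambda>x. \<Sum>i\<in>UNIV. (axis i (f x $ i) :: 'e^'m)) \<in> schwartz UNIV"
    by (intro schwartz_sum schwartz_bounded_linear[OF bl assms])
  ultimately show ?thesis by presburger
qed

section \<open>Derivatives along lines, symmetry of mixed partial derivatives, decay\<close>

lemma sum_axis:
  fixes c :: "'n::finite \<Rightarrow> real"
  shows "(\<Sum>i\<in>UNIV. axis k 1 $ i * c i) = c k"
  by (subst sum.remove[of _ k]) (auto simp: axis_def intro!: sum.neutral)

lemma has_real_derivative_line:
  fixes u :: "real^'n \<Rightarrow> real"
  assumes "u \<in> schwartz E"
  shows "((\<lambda>t. u (x + t *\<^sub>R v)) has_real_derivative
    (\<Sum>i\<in>UNIV. v $ i * partial_deriv i u (x + t *\<^sub>R v))) (at t)"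
  using has_vector_derivative_line[OF schwartz_differentiable[OF assms], where x = x and t = t and v = v]
  by (simp add: has_real_derivative_iff_has_vector_derivative)

lemma has_real_derivative_axis_line:
  fixes u :: "real^'n \<Rightarrow> real"
  assumes "u \<in> schwartz E"
  shows "((\<lambda>t. u (x + t *\<^sub>R axis k 1)) has_real_derivative
    partial_deriv k u (x + t *\<^sub>R axis k 1)) (at t)"
  using has_real_derivative_line[OF assms, of x "axis k 1" t] by (simp add: sum_axis)

text \<open>The second difference \<open>\<Delta> i j s\<close> is symmetric in \<open>i\<close> and
  \<open>j\<close>. The mean value theorem, used first in direction \<open>i\<close> and then in
  direction \<open>j\<close>, writes it as \<open>s\<^sup>2\<close> times a mixed derivative at a
  nearby point, and continuity gives the limit.\<close>

lemma partial_deriv_commute: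
  fixes f :: "real^'n \<Rightarrow> real"
  assumes "f \<in> schwartz UNIV"
  shows "partial_deriv i (partial_deriv j f) x = partial_deriv j (partial_deriv i f) x"
proof -
  define \<Delta> where "\<Delta> i j s = f (x + s *\<^sub>R axis i 1 + s *\<^sub>R axis j 1) - f (x + s *\<^sub>R axis i 1)
      - f (x + s *\<^sub>R axis j 1) + f x" for i j and s :: real
  have *: "((\<lambda>s. \<Delta> i j s / s\<^sup>2) \<longlongrightarrow> partial_deriv j (partial_deriv i f) x) (at_right 0)" for i j
  proof (rule tendstoI)
    fix e :: real assume e: "e > 0"
    define g where "g = partial_deriv j (partial_deriv i f)"
    have g: "g \<in> schwartz UNIV" and fi: "partial_deriv i f \<in> schwartz UNIV"
      unfolding g_def using assms by (auto intro: schwartz_partial_deriv)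
    have "isCont g x"
      using schwartz_differentiable[OF g] differentiable_imp_continuous_within by blast
    then obtain d where d: "d > 0" "\<And>y. dist y x < d \<Longrightarrow> dist (g y) (g x) < e"
      unfolding continuous_at_eps_delta using e by metis
    \<comment> \<open>The intermediate point is displaced by at most \<open>t + r\<close> with both
      summands below \<open>s\<close>, so \<open>d / 2\<close> keeps it within distance
      \<open>d\<close> of \<open>x\<close>.\<close>
    have "\<forall>\<^sub>F s in at_right (0::real). 0 < s \<and> s < d / 2"
      using d eventually_at_right_real[of 0 "d/2"] by (auto elim!: eventually_mono)
    then show "\<forall>\<^sub>F s in at_right 0. dist (\<Delta> i j s / s\<^sup>2) (partial_deriv j (partial_deriv i f) x) < e"
    proof eventually_elim
      case (elim s)
      define h where "h t = f (x + s *\<^sub>R axis j 1 + t *\<^sub>R axis i 1) - f (x + t *\<^sub>R axis i 1)" for t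
      have "\<exists>t>0. t < s \<and> h s - h 0 = (s - 0) *
          (partial_deriv i f (x + s *\<^sub>R axis j 1 + t *\<^sub>R axis i 1) - partial_deriv i f (x + t *\<^sub>R axis i 1))"
        unfolding h_def using elim by (intro MVT2 DERIV_diff has_real_derivative_axis_line[OF assms]) auto
      then obtain t where t: "0 < t" "t < s" "h s - h 0 = s *
          (partial_deriv i f (x + s *\<^sub>R axis j 1 + t *\<^sub>R axis i 1) - partial_deriv i f (x + t *\<^sub>R axis i 1))"
        by auto
      have "\<exists>r>0. r < s \<and> partial_deriv i f (x + t *\<^sub>R axis i 1 + s *\<^sub>R axis j 1)
          - partial_deriv i f (x + t *\<^sub>R axis i 1 + 0 *\<^sub>R axis j 1) = (s - 0) *
          g (x + t *\<^sub>R axis i 1 + r *\<^sub>R axis j 1)"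
        unfolding g_def using elim by (intro MVT2 has_real_derivative_axis_line[OF fi]) auto
      then obtain r where r: "0 < r" "r < s" "partial_deriv i f (x + t *\<^sub>R axis i 1 + s *\<^sub>R axis j 1)
          - partial_deriv i f (x + t *\<^sub>R axis i 1) = s * g (x + t *\<^sub>R axis i 1 + r *\<^sub>R axis j 1)"
        by auto
      have "\<Delta> i j s = h s - h 0" by (simp add: \<Delta>_def h_def algebra_simps)
      also have "\<dots> = s\<^sup>2 * g (x + t *\<^sub>R axis i 1 + r *\<^sub>R axis j 1)"
        using t(3) r(3) by (simp add: power2_eq_square add_ac)
      finally have "\<Delta> i j s / s\<^sup>2 = g (x + t *\<^sub>R axis i 1 + r *\<^sub>R axis j 1)"
        using elim by simp
      moreover have "norm (t *\<^sub>R axis i 1 + r *\<^sub>R axis j 1 :: real^'n) \<le> t + r"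
        using t r norm_triangle_ineq[of "t *\<^sub>R axis i 1" "r *\<^sub>R axis j 1 :: real^'n"] by (simp)
      ultimately show ?case
        using d(2)[of "x + t *\<^sub>R axis i 1 + r *\<^sub>R axis j 1"] t r elim
        by (simp add: dist_norm g_def add.assoc)
    qed
  qed
  have "\<Delta> j i = \<Delta> i j" by (auto simp: \<Delta>_def fun_eq_iff algebra_simps)
  with *[of i j] *[of j i] show ?thesis
    using tendsto_unique[OF trivial_limit_at_right_real] by metis
qed

text \<open>The definition bounds each power of the norm separately; the binomial expansion of
  \<open>(1 + (norm x)\<^sup>2) ^ m\<close> combines finitely many of these bounds.\<close>

lemma schwartz_decay:
  fixes f :: "real^'n \<Rightarrow> 'e::real_normed_vector"
  assumes "f \<in> schwartz E"
  obtains C where "0 \<le> C" "\<And>x. norm (f x) \<le> C / (1 + (norm x)\<^sup>2) ^ m"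
proof -
  have "\<exists>C. \<forall>x. norm (norm x ^ k *\<^sub>R f x) \<le> C" for k
  proof -
    have "bounded (range (\<lambda>x. norm x ^ k *\<^sub>R iter_partial [] f x))"
      using assms unfolding schwartz_def by blast
    then show ?thesis by (auto simp: bounded_iff)
  qed
  then obtain B where B: "\<And>k x. norm (norm x ^ k *\<^sub>R f x) \<le> B k" by metis
  define C where "C = (\<Sum>k\<le>m. real (m choose k) * B (2 * k))"
  have "(1 + (norm x)\<^sup>2) ^ m * norm (f x) \<le> C" for x
  proof -
    have "(1 + (norm x)\<^sup>2) ^ m * norm (f x) = (\<Sum>k\<le>m. real (m choose k) * norm (norm x ^ (2*k) *\<^sub>R f x))"
      using binomial_ring[of "(norm x)\<^sup>2" 1 m]
      by (simp add: add.commute sum_distrib_right mult.assoc power_mult)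
    also have "\<dots> \<le> C" unfolding C_def by (intro sum_mono mult_left_mono B) auto
    finally show ?thesis .
  qed
  moreover have "1 + (norm x)\<^sup>2 > 0" for x :: "real^'n" by (simp add: add_pos_nonneg)
  ultimately have *: "norm (f x) \<le> C / (1 + (norm x)\<^sup>2) ^ m" for x
    by (simp add: pos_le_divide_eq mult.commute)
  moreover have "C \<ge> 0" using *[of 0] norm_ge_zero[of "f 0"] by (simp del: norm_ge_zero)
  ultimately show ?thesis using that by blast
qed

section \<open>Line integrals and Fourier uniqueness\<close>

lemma integrable_lborel_translate:
  fixes f :: "'a::euclidean_space \<Rightarrow> 'b::{banach, second_countable_topology}"
  assumes "integrable lborel f"
  shows "integrable lborel (\<lambda>x. f (c + x))"
proof -
  have "integrable (distr lborel borel ((+) c)) f"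
    using assms by (simp add: lborel_distr_plus)
  then show ?thesis by (rule integrable_distr[rotated]) simp
qed

lemma integral_lborel_translate:
  fixes f :: "'a::euclidean_space \<Rightarrow> 'b::{banach, second_countable_topology}"
  assumes "f \<in> borel_measurable borel"
  shows "(\<integral>x. f (c + x) \<partial>lborel) = integral\<^sup>L lborel f"
proof -
  have "integral\<^sup>L (distr lborel borel ((+) c)) f = (\<integral>x. f (c + x) \<partial>lborel)"
    by (rule integral_distr) (use assms in auto)
  then show ?thesis by (simp add: lborel_distr_plus)
qed

lemma integral_lborel_scale:
  fixes f :: "'a::euclidean_space \<Rightarrow> real"
  assumes "f \<in> borel_measurable borel" "c > 0"
  shows "integral\<^sup>L lborel f = c ^ DIM('a) * (\<integral>x. f (t + c *\<^sub>R x) \<partial>lborel)"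
proof -
  have "integral\<^sup>L lborel f =
      integral\<^sup>L (density (distr lborel borel (\<lambda>x. t + c *\<^sub>R x)) (\<lambda>_. \<bar>c\<bar>^DIM('a))) f"
    using lborel_affine[of c t] assms by simp
  also have "\<dots> = integral\<^sup>L (distr lborel borel (\<lambda>x. t + c *\<^sub>R x)) (\<lambda>x. \<bar>c\<bar>^DIM('a) * f x)"
    using assms by (subst integral_real_density) auto
  also have "\<dots> = (\<integral>x. \<bar>c\<bar>^DIM('a) * f (t + c *\<^sub>R x) \<partial>lborel)"
    by (rule integral_distr) (use assms in auto)
  finally show ?thesis using assms by simp
qed

lemma std_normal_density_integral: "integral\<^sup>L lborel std_normal_density = 1"
  using integral_normal_moment_even[of 1 0 0] by simp

lemma integral_eq_0_if_line_integrals_eq_0: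
  fixes G :: "'a::euclidean_space \<Rightarrow> real"
  assumes G: "integrable lborel G" and v: "norm v = 1"
    and lines: "\<And>x. (\<integral>t. G (x + t *\<^sub>R v) \<partial>lborel) = 0"
  shows "integral\<^sup>L lborel G = 0"
proof -
  txt \<open>Insert the weight \<open>\<integral> \<rho> (x \<bullet> v - t) dt = 1\<close> and translate \<open>x\<close> by \<open>t *\<^sub>R v\<close>: this produces the line
    integrals of \<open>G\<close> without choosing coordinates adapted to \<open>v\<close>.\<close>
  define \<rho> where "\<rho> = std_normal_density"
  have [measurable]: "G \<in> borel_measurable borel" "\<rho> \<in> borel_measurable borel"
    using G by (auto simp: \<rho>_def)
  have \<rho>: "integrable lborel \<rho>" "integral\<^sup>L lborel \<rho> = 1" "\<And>s. \<rho> s \<ge> 0"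
    using std_normal_density_integral by (auto simp: \<rho>_def)
  have \<rho>': "integrable lborel (\<lambda>t. \<rho> (s - t))" "(\<integral>t. \<rho> (s - t) \<partial>lborel) = 1" for s
    using lborel_integrable_real_affine[OF \<rho>(1), of "-1" s]
      lborel_integral_real_affine[of "-1" \<rho> s] \<rho>(2) by auto
  have vv: "v \<bullet> v = 1" using v by (simp add: norm_eq_1)
  define K where "K = (\<lambda>(t, x). G x * \<rho> (x \<bullet> v - t))"
  define J where "J = (\<lambda>(t, x). G (x + t *\<^sub>R v) * \<rho> (x \<bullet> v))"
  have K1: "integrable (lborel \<Otimes>\<^sub>M lborel) (\<lambda>(x, t). K (t, x))"
  proof (rule lborel_pair.Fubini_integrable)
    show "integrable lborel (\<lambda>x. \<integral>t. norm ((\<lambda>(x, t). K (t, x)) (x, t)) \<partial>lborel)"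
      using G \<rho>' \<rho>(3) by (simp add: K_def abs_mult)
  qed (use \<rho>' in \<open>auto simp: K_def\<close>)
  then have K2: "integrable (lborel \<Otimes>\<^sub>M lborel) K"
    using lborel_pair.integrable_product_swap_iff[of K] by (simp add: split_beta')
  \<comment> \<open>For fixed \<open>t\<close> the function \<open>J\<close> is \<open>K\<close>
    translated by \<open>t *\<^sub>R v\<close>. Below, \<open>h\<close> is the norm, for
    integrability, and the identity, for the value.\<close>
  have KJ: "(\<integral>x. h (J (t, x)) \<partial>lborel) = (\<integral>x. h (K (t, x)) \<partial>lborel)"
    if [measurable]: "h \<in> borel_measurable borel" for t and h :: "real \<Rightarrow> real"
  proof -
    have "(\<integral>x. h (K (t, x)) \<partial>lborel) = (\<integral>x. h (K (t, t *\<^sub>R v + x)) \<partial>lborel)"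
      by (rule integral_lborel_translate[symmetric]) (simp add: K_def)
    moreover have "K (t, t *\<^sub>R v + x) = J (t, x)" for x
      by (simp add: K_def J_def inner_simps vv add.commute)
    ultimately show ?thesis by simp
  qed
  have J2: "integrable (lborel \<Otimes>\<^sub>M lborel) J"
  proof (rule lborel_pair.Fubini_integrable)
    show "J \<in> borel_measurable (lborel \<Otimes>\<^sub>M lborel)" by (simp add: J_def)
    have "integrable lborel (\<lambda>t. \<integral>x. norm (K (t, x)) \<partial>lborel)"
      using lborel_pair.integrable_fst'[OF integrable_norm[OF K2]] by simp
    then show "integrable lborel (\<lambda>t. \<integral>x. norm (J (t, x)) \<partial>lborel)"
      by (simp add: KJ)
    have "AE t in lborel. integrable lborel (\<lambda>x. K (t, x))"
      using lborel_pair.AE_integrable_fst'[OF K2] .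
    then show "AE t in lborel. integrable lborel (\<lambda>x. J (t, x))"
    proof eventually_elim
      case (elim t)
      from integrable_lborel_translate[OF elim, of "t *\<^sub>R v"] show ?case
        by (simp add: K_def J_def inner_simps vv add.commute)
    qed
  qed
  have "integral\<^sup>L lborel G = (\<integral>x. \<integral>t. K (t, x) \<partial>lborel \<partial>lborel)"
    using \<rho>' by (simp add: K_def)
  also have "\<dots> = (\<integral>t. \<integral>x. K (t, x) \<partial>lborel \<partial>lborel)"
    using lborel_pair.Fubini_integral[of "\<lambda>t x. K (t, x)"] K2 by simp
  also have "\<dots> = (\<integral>t. \<integral>x. J (t, x) \<partial>lborel \<partial>lborel)"
    using KJ[of "\<lambda>x. x"] by simp
  also have "\<dots> = (\<integral>x. \<integral>t. J (t, x) \<partial>lborel \<partial>lborel)"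
    using lborel_pair.Fubini_integral[of "\<lambda>t x. J (t, x)"] J2 by simp
  also have "\<dots> = 0" using lines by (simp add: J_def)
  finally show ?thesis .
qed

text \<open>\<open>lborel\<close> is the image of the product measure indexed by
  \<open>Basis\<close> under the coordinate map, so a product of one-dimensional factors integrates
  factor by factor.\<close>

lemma lborel_prod_integral:
  fixes f :: "'a::euclidean_space \<Rightarrow> real \<Rightarrow> 'b::{real_normed_field, banach, second_countable_topology}"
  assumes "\<And>b. b \<in> Basis \<Longrightarrow> integrable lborel (f b)"
  shows integrable_lborel_prod: "integrable lborel (\<lambda>x. \<Prod>b\<in>Basis. f b (x \<bullet> b))"
    and integral_lborel_prod:
      "(\<integral>x. (\<Prod>b\<in>Basis. f b (x \<bullet> b)) \<partial>lborel) = (\<Prod>b\<in>Basis. integral\<^sup>L lborel (f b))"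
proof -
  interpret product_sigma_finite "\<lambda>_::'a. lborel :: real measure" ..
  have [measurable]: "f b \<in> borel_measurable borel" if "b \<in> Basis" for b
    using assms[OF that] by auto
  have inner: "(\<Sum>b\<in>Basis. g b *\<^sub>R b) \<bullet> c = g c" if "c \<in> Basis" for g and c :: 'a
    using that by (simp add: inner_sum_left inner_Basis if_distrib cong: if_cong)
  have m: "(\<lambda>g. \<Sum>b\<in>Basis. g b *\<^sub>R b) \<in> measurable (Pi\<^sub>M Basis (\<lambda>_::'a. lborel)) borel"
    by measurable
  have fm: "(\<lambda>x. \<Prod>b\<in>Basis. f b (x \<bullet> b)) \<in> borel_measurable borel" by measurable
  have eq: "(\<Prod>b\<in>Basis. f b ((\<Sum>b\<in>Basis. g b *\<^sub>R b) \<bullet> b)) = (\<Prod>b\<in>Basis. f b (g b))" for g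
    by (rule prod.cong) (auto simp: inner)
  show "integrable lborel (\<lambda>x. \<Prod>b\<in>Basis. f b (x \<bullet> b))"
    unfolding lborel_eq[where 'a = 'a] integrable_distr_eq[OF m fm] eq
    by (rule product_integrable_prod) (use assms in auto)
  show "(\<integral>x. (\<Prod>b\<in>Basis. f b (x \<bullet> b)) \<partial>lborel) = (\<Prod>b\<in>Basis. integral\<^sup>L lborel (f b))"
    unfolding lborel_eq[where 'a = 'a] integral_distr[OF m fm] eq
    by (rule product_integral_prod) (use assms in auto)
qed

section \<open>Gaussian integrals and Fourier uniqueness\<close>

definition gauss :: "'a::euclidean_space \<Rightarrow> real"
  where "gauss x = (\<Prod>b\<in>Basis. std_normal_density (x \<bullet> b))"

lemma gauss_measurable [measurable]: "gauss \<in> borel_measurable borel"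
  unfolding gauss_def[abs_def] by measurable

lemma gauss_nonneg: "gauss x \<ge> 0"
  by (simp add: gauss_def prod_nonneg)

lemma integrable_gauss: "integrable lborel gauss"
  unfolding gauss_def[abs_def] by (rule integrable_lborel_prod) simp

lemma integral_gauss: "integral\<^sup>L lborel gauss = 1"
  unfolding gauss_def[abs_def] by (subst integral_lborel_prod) (auto simp: std_normal_density_integral)

text \<open>Up to a constant the Gaussian is its own Fourier transform: the complex exponential
  factors over the coordinates, each factor integrates to the characteristic function of the
  standard normal distribution, and the real part gives the cosine.\<close>

lemma integral_gauss_cos:
  fixes z :: "'a::euclidean_space"
  shows "(\<integral>y. gauss y * cos (y \<bullet> z) \<partial>lborel) = sqrt (2 * pi) ^ DIM('a) * gauss z"
proof -
  define f where "f b s = complex_of_real (std_normal_density s) * iexp ((z \<bullet> b) * s)" for b s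
  have int: "integrable lborel (f b)" for b
    unfolding f_def
    by (rule Bochner_Integration.integrable_bound[of _ std_normal_density]) (auto simp: norm_mult)
  have f: "integral\<^sup>L lborel (f b) = complex_of_real (exp (- ((z \<bullet> b)^2) / 2))" for b
  proof -
    have "char std_normal_distribution (z \<bullet> b) = integral\<^sup>L lborel (f b)"
      unfolding char_def f_def
      by (subst integral_density) (auto simp: scaleR_conv_of_real)
    then show ?thesis by (simp add: char_std_normal_distribution)
  qed
  have prod: "(\<Prod>b\<in>Basis. f b (y \<bullet> b)) = complex_of_real (gauss y) * cis (y \<bullet> z)" for y
  proof -
    have "(\<Prod>b\<in>Basis. iexp ((z \<bullet> b) * (y \<bullet> b))) = exp (\<Sum>b\<in>Basis. \<i> * complex_of_real ((z \<bullet> b) * (y \<bullet> b)))"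
      by (simp add: exp_sum)
    also have "\<dots> = cis (y \<bullet> z)"
      unfolding euclidean_inner[of y z] cis_conv_exp by (simp add: sum_distrib_left mult_ac)
    finally show ?thesis by (simp add: f_def gauss_def prod.distrib)
  qed
  have "integrable lborel (\<lambda>y. complex_of_real (gauss y) * cis (y \<bullet> z))"
    using integrable_lborel_prod[of f] int by (simp add: prod)
  moreover have "(\<integral>y. complex_of_real (gauss y) * cis (y \<bullet> z) \<partial>lborel)
      = complex_of_real (\<Prod>b\<in>Basis. exp (- ((z \<bullet> b)^2) / 2))"
    using integral_lborel_prod[of f] int by (simp add: prod f)
  ultimately have "(\<integral>y. Re (complex_of_real (gauss y) * cis (y \<bullet> z)) \<partial>lborel)
      = (\<Prod>b\<in>Basis. exp (- ((z \<bullet> b)^2) / 2))"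
    by (metis Re_complex_of_real integral_Re)
  also have "\<dots> = (\<Prod>b\<in>Basis. sqrt (2 * pi) * std_normal_density (z \<bullet> b))"
    by (simp add: std_normal_density_def)
  also have "\<dots> = sqrt (2 * pi) ^ DIM('a) * gauss z"
    by (simp add: gauss_def prod.distrib)
  finally show ?thesis by simp
qed

text \<open>Averaging the vanishing integrals over all frequencies with Gaussian weight shows that
  the Gaussian smoothing of \<open>f\<close> at scale \<open>r\<close> is 0 at \<open>x\<close>;
  letting \<open>r\<close> tend to 0 recovers \<open>f x\<close>.\<close>

lemma fourier_unique:
  fixes f :: "'a::euclidean_space \<Rightarrow> real"
  assumes f: "integrable lborel f" and cont: "continuous_on UNIV f" and bdd: "\<And>x. \<bar>f x\<bar> \<le> B"
    and vanish: "\<And>\<xi> \<theta>. \<xi> \<noteq> 0 \<Longrightarrow> (\<integral>x. f x * cos (\<xi> \<bullet> x + \<theta>) \<partial>lborel) = 0"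
  shows "f x = 0"
proof -
  have [measurable]: "f \<in> borel_measurable borel" using f by simp
  have zero: "(\<integral>z. f (x + r *\<^sub>R z) * gauss z \<partial>lborel) = 0" if r: "r > 0" for r
  proof -
    \<comment> \<open>The weight \<open>gauss \<eta>\<close> makes the double integral over
      frequency and space absolutely convergent, so the order of integration can be
      exchanged.\<close>
    define M where "M = (\<lambda>(\<eta>, y). gauss \<eta> * (f y * cos (\<eta> \<bullet> ((y - x) /\<^sub>R r))))"
    have "integrable (lborel \<Otimes>\<^sub>M lborel) (\<lambda>(\<eta>, y). gauss \<eta> * f y)"
      by (rule lborel_pair.Fubini_integrable)
        (use f in \<open>auto simp: abs_mult integrable_gauss\<close>)
    then have M: "integrable (lborel \<Otimes>\<^sub>M lborel) M"
    proof (rule Bochner_Integration.integrable_bound)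
      have "\<bar>gauss \<eta> * (f y * cos s)\<bar> \<le> \<bar>gauss \<eta> * f y\<bar>" for \<eta> :: 'a and y s
        by (simp add: abs_mult mult_left_le mult_left_mono)
      then show "AE p in lborel \<Otimes>\<^sub>M lborel. norm (M p) \<le> norm (case p of (\<eta>, y) \<Rightarrow> gauss \<eta> * f y)"
        by (intro AE_I2) (simp add: M_def split_beta')
    qed (simp add: M_def)
    have "(\<integral>y. M (\<eta>, y) \<partial>lborel) = 0" if "\<eta> \<noteq> 0" for \<eta>
    proof -
      have "(\<integral>y. f y * cos (\<eta> \<bullet> ((y - x) /\<^sub>R r)) \<partial>lborel)
          = (\<integral>y. f y * cos ((\<eta> /\<^sub>R r) \<bullet> y + (- (\<eta> /\<^sub>R r) \<bullet> x)) \<partial>lborel)"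
        by (simp add: inner_simps algebra_simps)
      also have "\<dots> = 0" using that r by (intro vanish) simp
      finally show ?thesis by (simp add: M_def)
    qed
    \<comment> \<open>\<open>vanish\<close> concerns nonzero frequencies, and the remaining single
      point is a null set.\<close>
    then have "AE \<eta> in lborel. (\<integral>y. M (\<eta>, y) \<partial>lborel) = 0"
      using AE_lborel_singleton[of "0::'a"] by auto
    then have "0 = (\<integral>\<eta>. \<integral>y. M (\<eta>, y) \<partial>lborel \<partial>lborel)"
      by (subst integral_cong_AE[where g = "\<lambda>_. 0"]) (use M in auto)
    also have "\<dots> = (\<integral>y. \<integral>\<eta>. M (\<eta>, y) \<partial>lborel \<partial>lborel)"
      using lborel_pair.Fubini_integral[of "\<lambda>\<eta> y. M (\<eta>, y)"] M by simp
    also have "\<dots> = (\<integral>y. f y * (\<integral>\<eta>. gauss \<eta> * cos (\<eta> \<bullet> ((y - x) /\<^sub>R r)) \<partial>lborel) \<partial>lborel)"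
      unfolding M_def prod.case mult.left_commute[of "gauss _" "f _"] integral_mult_right_zero ..
    also have "\<dots> = sqrt (2 * pi) ^ DIM('a) * (\<integral>y. f y * gauss ((y - x) /\<^sub>R r) \<partial>lborel)"
      unfolding integral_gauss_cos mult.left_commute[of "f _"] integral_mult_right_zero ..
    finally have "(\<integral>y. f y * gauss ((y - x) /\<^sub>R r) \<partial>lborel) = 0" by simp
    then show ?thesis
      using integral_lborel_scale[of "\<lambda>y. f y * gauss ((y - x) /\<^sub>R r)" r x] r by simp
  qed
  \<comment> \<open>Boundedness of \<open>f\<close> supplies the dominating function
    \<open>B * gauss z\<close>, continuity the pointwise limit.\<close>
  have "(\<lambda>n. \<integral>z. f (x + inverse (real (Suc n)) *\<^sub>R z) * gauss z \<partial>lborel)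
      \<longlonglongrightarrow> (\<integral>z. f x * gauss (z::'a) \<partial>lborel)"
  proof (rule integral_dominated_convergence)
    show "integrable lborel (\<lambda>z::'a. B * gauss z)"
      by (simp add: integrable_gauss)
    have "(\<lambda>n. f (x + inverse (real (Suc n)) *\<^sub>R z) * gauss z) \<longlonglongrightarrow> f x * gauss z" for z
    proof -
      have "(\<lambda>n. x + inverse (real (Suc n)) *\<^sub>R z) \<longlonglongrightarrow> x + 0 *\<^sub>R z"
        by (intro tendsto_intros LIMSEQ_inverse_real_of_nat)
      moreover have "isCont f x" using cont by (simp add: continuous_on_eq_continuous_at)
      ultimately have "(\<lambda>n. f (x + inverse (real (Suc n)) *\<^sub>R z)) \<longlonglongrightarrow> f x"
        by (intro isCont_tendsto_compose[of x f]) auto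
      then show ?thesis by (intro tendsto_intros)
    qed
    then show "AE z in lborel. (\<lambda>n. f (x + inverse (real (Suc n)) *\<^sub>R z) * gauss z) \<longlonglongrightarrow> f x * gauss z"
      by simp
    show "AE z in lborel. norm (f (x + inverse (real (Suc n)) *\<^sub>R z) * gauss z) \<le> B * gauss z" for n
      using bdd by (intro always_eventually)
        (auto simp: abs_mult gauss_nonneg intro!: mult_right_mono)
  qed auto
  then show ?thesis
    using LIMSEQ_unique[OF _ tendsto_const] zero by (simp add: integral_gauss LIMSEQ_const_iff)
qed

section \<open>Integrability and limits from decay\<close>

lemma integrable_inverse_1_plus_square_lborel: "integrable lborel (\<lambda>x::real. inverse (1 + x\<^sup>2))"
  using integrable_inverse_1_plus_square by (simp add: set_integrable_def)

text \<open>The exponent provides one factor per coordinate: as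
  \<open>1 + (x \<bullet> b)\<^sup>2\<close> is at most \<open>1 + (norm x)\<^sup>2\<close>, a
  product of integrable one-dimensional functions dominates.\<close>

lemma integrable_if_decay:
  fixes f :: "'a::euclidean_space \<Rightarrow> real"
  assumes [measurable]: "f \<in> borel_measurable borel"
    and decay: "\<And>x. \<bar>f x\<bar> \<le> C / (1 + (norm x)\<^sup>2) ^ DIM('a)"
  shows "integrable lborel f"
proof (rule Bochner_Integration.integrable_bound)
  have C: "C \<ge> 0" using decay[of 0] by simp
  show "integrable lborel (\<lambda>x. C * (\<Prod>b\<in>Basis. inverse (1 + (x \<bullet> b)\<^sup>2)) :: real)" for x :: 'a
    by (intro integrable_mult_right integrable_lborel_prod integrable_inverse_1_plus_square_lborel)
  have "\<bar>f x\<bar> \<le> C * (\<Prod>b\<in>Basis. inverse (1 + (x \<bullet> b)\<^sup>2))" for x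
  proof -
    have pos: "0 < (\<Prod>b\<in>Basis. 1 + (x \<bullet> b)\<^sup>2)" by (intro prod_pos) (simp add: add_pos_nonneg)
    have "(\<Prod>b\<in>Basis. 1 + (x \<bullet> b)\<^sup>2) \<le> (\<Prod>b\<in>(Basis::'a set). 1 + (norm x)\<^sup>2)"
      using Basis_le_norm[of _ x] by (intro prod_mono) (auto simp: abs_le_square_iff[symmetric])
    then have "C / (1 + (norm x)\<^sup>2) ^ DIM('a) \<le> C / (\<Prod>b\<in>Basis. 1 + (x \<bullet> b)\<^sup>2)"
      using pos C by (intro divide_left_mono) auto
    with decay[of x] show ?thesis by (simp add: divide_inverse prod_inversef[symmetric] o_def)
  qed
  then show "AE x in lborel. norm (f x) \<le> norm (C * (\<Prod>b\<in>Basis. inverse (1 + (x \<bullet> b)\<^sup>2)))"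
    using order_trans[OF _ abs_ge_self] by auto
qed simp

text \<open>By Cauchy-Schwarz the norm of a point on the line is at least the absolute value of its
  coordinate \<open>x \<bullet> v + t\<close>, so a translated one-dimensional bound
  dominates.\<close>

lemma integrable_line_if_decay:
  fixes f :: "'a::euclidean_space \<Rightarrow> real"
  assumes [measurable]: "f \<in> borel_measurable borel" and v: "norm v = 1"
    and decay: "\<And>x. \<bar>f x\<bar> \<le> C / (1 + (norm x)\<^sup>2)"
  shows "integrable lborel (\<lambda>t. f (x + t *\<^sub>R v))"
proof (rule Bochner_Integration.integrable_bound)
  have C: "C \<ge> 0" using decay[of 0] by simp
  show "integrable lborel (\<lambda>t. C * inverse (1 + (x \<bullet> v + t)\<^sup>2) :: real)"
    using integrable_lborel_translate[OF integrable_inverse_1_plus_square_lborel, of "x \<bullet> v"]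
    by (intro integrable_mult_right)
  have "\<bar>f (x + t *\<^sub>R v)\<bar> \<le> C * inverse (1 + (x \<bullet> v + t)\<^sup>2)" for t
  proof -
    have "\<bar>x \<bullet> v + t\<bar> \<le> norm (x + t *\<^sub>R v)"
      using Cauchy_Schwarz_ineq2[of "x + t *\<^sub>R v" v] v by (simp add: inner_simps norm_eq_1)
    then have "(x \<bullet> v + t)\<^sup>2 \<le> (norm (x + t *\<^sub>R v))\<^sup>2"
      by (simp add: abs_le_square_iff[symmetric])
    then have "C / (1 + (norm (x + t *\<^sub>R v))\<^sup>2) \<le> C / (1 + (x \<bullet> v + t)\<^sup>2)"
      using C by (intro divide_left_mono) (auto simp: add_pos_nonneg)
    with decay[of "x + t *\<^sub>R v"] show ?thesis by (simp add: divide_inverse)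
  qed
  then show "AE t in lborel. norm (f (x + t *\<^sub>R v)) \<le> norm (C * inverse (1 + (x \<bullet> v + t)\<^sup>2))"
    using order_trans[OF _ abs_ge_self] by auto
qed simp

lemma integral_derivative_eq_0:
  fixes g :: "real \<Rightarrow> real"
  assumes g: "\<And>t. (g has_vector_derivative g' t) (at t)"
    and cont: "\<And>t. isCont g' t" and int: "integrable lborel g'"
    and lim: "(g \<longlongrightarrow> 0) at_top" "(g \<longlongrightarrow> 0) at_bot"
  shows "integral\<^sup>L lborel g' = 0"
proof -
  have "(LBINT t=-\<infinity>..\<infinity>. g' t) = 0 - 0"
  proof (rule interval_integral_FTC_integrable)
    show "set_integrable lborel (einterval (-\<infinity>) \<infinity>) g'"
      using int by (simp add: set_integrable_def)
    show "((g \<circ> real_of_ereal) \<longlongrightarrow> 0) (at_right (-\<infinity>))"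
      "((g \<circ> real_of_ereal) \<longlongrightarrow> 0) (at_left \<infinity>)"
      using lim by (simp_all add: ereal_tendsto_simps)
  qed (use g cont in auto)
  then show ?thesis
    by (simp add: interval_lebesgue_integral_def set_lebesgue_integral_def)
qed

text \<open>The filter is left general so that \<open>at_top\<close> and \<open>at_bot\<close>, the
  two ends of the line, are covered by one argument.\<close>

lemma line_tendsto_0_if_decay:
  fixes f :: "'a::euclidean_space \<Rightarrow> real"
  assumes v: "norm v = 1" and decay: "\<And>x. \<bar>f x\<bar> \<le> C / (1 + (norm x)\<^sup>2)"
    and F: "F \<le> at_infinity"
  shows "((\<lambda>t. f (x + t *\<^sub>R v)) \<longlongrightarrow> 0) F"
proof -
  have "filterlim (\<lambda>t. x + t *\<^sub>R v) at_infinity at_infinity"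
  proof -
    have "(\<lambda>t. norm (t *\<^sub>R v)) = norm" using v by auto
    then have "filterlim (\<lambda>t. norm (t *\<^sub>R v)) at_top at_infinity"
      using filterlim_norm_at_top by simp
    then have "filterlim (\<lambda>t. t *\<^sub>R v) at_infinity at_infinity"
      by (rule filterlim_norm_at_top_imp_at_infinity)
    then show ?thesis by (rule tendsto_add_filterlim_at_infinity[OF tendsto_const])
  qed
  then have "filterlim (\<lambda>t. x + t *\<^sub>R v) at_infinity F"
    by (rule filterlim_mono[OF _ order_refl F])
  then have "filterlim (\<lambda>t. norm (x + t *\<^sub>R v)) at_top F"
    by (rule filterlim_compose[OF filterlim_norm_at_top])
  moreover have "((\<lambda>r::real. C / (1 + r\<^sup>2)) \<longlongrightarrow> 0) at_top"
    by real_asymp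
  ultimately have "((\<lambda>t. C / (1 + (norm (x + t *\<^sub>R v))\<^sup>2)) \<longlongrightarrow> 0) F"
    by (rule filterlim_compose[rotated])
  then show ?thesis
    by (rule Lim_null_comparison[rotated]) (use decay in \<open>auto intro!: always_eventually\<close>)
qed

section \<open>The cosine transform of Schwartz functions\<close>

lemma schwartz_isCont: "u \<in> schwartz E \<Longrightarrow> isCont u x"
  by (rule differentiable_imp_continuous_within[OF schwartz_differentiable])

lemma schwartz_borel_measurable:
  "u \<in> schwartz E \<Longrightarrow> u \<in> borel_measurable borel"
  by (auto intro!: borel_measurable_continuous_onI continuous_at_imp_continuous_on schwartz_isCont)

lemma schwartz_integrable:
  fixes u :: "real^'n \<Rightarrow> real"
  assumes "u \<in> schwartz E"
  shows "integrable lborel u"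
proof -
  obtain C where "\<And>x. norm (u x) \<le> C / (1 + (norm x)\<^sup>2) ^ DIM(real^'n)"
    using schwartz_decay[OF assms] by metis
  then show ?thesis
    by (intro integrable_if_decay schwartz_borel_measurable[OF assms]) simp
qed

lemma schwartz_decay2:
  fixes u :: "real^'n \<Rightarrow> real"
  assumes "u \<in> schwartz E"
  obtains C where "0 \<le> C" "\<And>x. \<bar>u x\<bar> \<le> C / (1 + (norm x)\<^sup>2)"
  using schwartz_decay[OF assms, where m = 1] by (metis power_one_right real_norm_def)

lemma schwartz_integrable_line:
  fixes u :: "real^'n \<Rightarrow> real"
  assumes "u \<in> schwartz E" "norm v = 1"
  shows "integrable lborel (\<lambda>t. u (x + t *\<^sub>R v))"
  using schwartz_decay2[OF assms(1)] assms
  by (metis integrable_line_if_decay schwartz_borel_measurable)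

text \<open>The integrand is the derivative of \<open>u\<close> along the line, and \<open>u\<close>
  tends to 0 at both ends.\<close>

lemma integral_line_derivative:
  fixes u :: "real^'n \<Rightarrow> real"
  assumes u: "u \<in> schwartz UNIV" and v: "norm v = 1"
  shows "(\<integral>t. (\<Sum>i\<in>UNIV. v $ i * partial_deriv i u (x + t *\<^sub>R v)) \<partial>lborel) = 0"
proof (rule integral_derivative_eq_0)
  define w where "w = (\<lambda>y. \<Sum>i\<in>UNIV. v $ i * partial_deriv i u y)"
  have w: "w \<in> schwartz UNIV"
    unfolding w_def by (intro schwartz_sum schwartz_mult_left schwartz_partial_deriv[OF u])
  show "((\<lambda>t. u (x + t *\<^sub>R v)) has_vector_derivative
      (\<Sum>i\<in>UNIV. v $ i * partial_deriv i u (x + t *\<^sub>R v))) (at t)" for t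
    using has_real_derivative_line[OF u] by (simp add: has_real_derivative_iff_has_vector_derivative)
  show "isCont (\<lambda>t. \<Sum>i\<in>UNIV. v $ i * partial_deriv i u (x + t *\<^sub>R v)) t" for t
    using isCont_o2[OF _ schwartz_isCont[OF w], of t "\<lambda>t. x + t *\<^sub>R v"] unfolding w_def by simp
  show "integrable lborel (\<lambda>t. \<Sum>i\<in>UNIV. v $ i * partial_deriv i u (x + t *\<^sub>R v))"
    using schwartz_integrable_line[OF w v] unfolding w_def .
  obtain C where "\<And>x. \<bar>u x\<bar> \<le> C / (1 + (norm x)\<^sup>2)" using schwartz_decay2[OF u] by metis
  then show "((\<lambda>t. u (x + t *\<^sub>R v)) \<longlongrightarrow> 0) at_top" "((\<lambda>t. u (x + t *\<^sub>R v)) \<longlongrightarrow> 0) at_bot"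
    by (intro line_tendsto_0_if_decay v at_top_le_at_infinity at_bot_le_at_infinity; blast)+
qed

text \<open>The phases \<open>\<theta> = 0\<close> and \<open>\<theta> = pi / 2\<close> give the real and imaginary part of the Fourier transform
  (up to sign), so that differentiation becomes multiplication by a frequency and a phase shift.\<close>

definition cos_transform :: "(real^'n::finite \<Rightarrow> real) \<Rightarrow> real^'n \<Rightarrow> real \<Rightarrow> real"
  where "cos_transform u \<xi> \<theta> = (\<integral>x. u x * cos (\<xi> \<bullet> x + \<theta>) \<partial>lborel)"

lemma integrable_mult_bounded:
  fixes u g :: "'a::euclidean_space \<Rightarrow> real"
  assumes "integrable lborel u" "g \<in> borel_measurable borel" "\<And>x. \<bar>g x\<bar> \<le> 1"
  shows "integrable lborel (\<lambda>x. u x * g x)"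
  by (rule Bochner_Integration.integrable_bound[OF assms(1)])
    (use assms in \<open>auto simp: abs_mult mult_left_le\<close>)

lemma cos_transform_integrable:
  "u \<in> schwartz E \<Longrightarrow> integrable lborel (\<lambda>x. u x * cos (\<xi> \<bullet> x + \<theta>))"
  by (rule integrable_mult_bounded) (auto intro: schwartz_integrable)

lemma cos_transform_zero [simp]: "cos_transform (\<lambda>x. 0) \<xi> \<theta> = 0"
  by (simp add: cos_transform_def)

lemma cos_transform_sum:
  assumes "\<And>s. s \<in> S \<Longrightarrow> u s \<in> schwartz UNIV"
  shows "cos_transform (\<lambda>x. \<Sum>s\<in>S. u s x) \<xi> \<theta> = (\<Sum>s\<in>S. cos_transform (u s) \<xi> \<theta>)"
  unfolding cos_transform_def sum_distrib_right
  by (rule Bochner_Integration.integral_sum) (auto intro: cos_transform_integrable assms)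

lemma cos_transform_mult_right:
  "cos_transform (\<lambda>x. u x * c) \<xi> \<theta> = cos_transform u \<xi> \<theta> * c"
  unfolding cos_transform_def by (simp add: mult.assoc mult.commute[of c] flip: integral_mult_left_zero)

text \<open>Since \<open>v\<close> is orthogonal to \<open>\<xi>\<close>, the cosine is constant
  along every line in direction \<open>v\<close> and factors out of the line integral.\<close>

lemma cos_transform_slice:
  assumes u: "u \<in> schwartz UNIV" and v: "norm v = 1" "v \<bullet> \<xi> = 0"
    and lines: "\<And>x. (\<integral>t. u (x + t *\<^sub>R v) \<partial>lborel) = 0"
  shows "cos_transform u \<xi> \<theta> = 0"
  unfolding cos_transform_def
proof (rule integral_eq_0_if_line_integrals_eq_0[OF cos_transform_integrable[OF u] v(1)])
  fix x
  have "cos (\<xi> \<bullet> (x + t *\<^sub>R v) + \<theta>) = cos (\<xi> \<bullet> x + \<theta>)" for t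
    using v by (simp add: inner_simps inner_commute)
  then show "(\<integral>t. u (x + t *\<^sub>R v) * cos (\<xi> \<bullet> (x + t *\<^sub>R v) + \<theta>) \<partial>lborel) = 0"
    using lines by simp
qed

text \<open>Integration by parts, carried out line by line: \<open>G\<close> is the derivative of
  \<open>w\<close> in direction \<open>axis k 1\<close>, so its integral over each line in that
  direction vanishes, and with it the integral over the whole space.\<close>

lemma cos_transform_partial_deriv:
  assumes u: "u \<in> schwartz UNIV"
  shows "cos_transform (partial_deriv k u) \<xi> \<theta> = \<xi> $ k * cos_transform u \<xi> (\<theta> - pi / 2)"
proof -
  define v :: "real^'a" where "v = axis k 1"
  have v: "norm v = 1" "\<xi> \<bullet> v = \<xi> $ k" by (auto simp: v_def inner_axis)
  note u' = schwartz_partial_deriv[OF u, of k]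
  define w where "w x = u x * cos (\<xi> \<bullet> x + \<theta>)" for x
  define G where "G x = partial_deriv k u x * cos (\<xi> \<bullet> x + \<theta>) - \<xi> $ k * (u x * cos (\<xi> \<bullet> x + (\<theta> - pi / 2)))" for x
  obtain C where C: "0 \<le> C" "\<And>x. \<bar>u x\<bar> \<le> C / (1 + (norm x)\<^sup>2)"
    using schwartz_decay2[OF u] by metis
  obtain C' where C': "0 \<le> C'" "\<And>x. \<bar>partial_deriv k u x\<bar> \<le> C' / (1 + (norm x)\<^sup>2)"
    using schwartz_decay2[OF u'] by metis
  have bound: "\<bar>a * cos s\<bar> \<le> \<bar>a\<bar>" for a s :: real by (simp add: abs_mult mult_left_le)
  have w: "\<bar>w x\<bar> \<le> C / (1 + (norm x)\<^sup>2)" for x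
    unfolding w_def using order_trans[OF bound C(2)] .
  have G_bound: "\<bar>G x\<bar> \<le> (C' + \<bar>\<xi> $ k\<bar> * C) / (1 + (norm x)\<^sup>2)" for x
  proof -
    have "\<bar>G x\<bar> \<le> \<bar>partial_deriv k u x * cos (\<xi> \<bullet> x + \<theta>)\<bar> + \<bar>\<xi> $ k\<bar> * \<bar>u x * cos (\<xi> \<bullet> x + (\<theta> - pi / 2))\<bar>"
      unfolding G_def by (metis abs_mult abs_triangle_ineq4)
    also have "\<dots> \<le> C' / (1 + (norm x)\<^sup>2) + \<bar>\<xi> $ k\<bar> * (C / (1 + (norm x)\<^sup>2))"
      by (intro add_mono mult_left_mono order_trans[OF bound C(2)] order_trans[OF bound C'(2)]) simp
    finally show ?thesis by (simp add: add_divide_distrib)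
  qed
  have "continuous_on UNIV G"
    unfolding G_def using u u'
    by (intro continuous_intros continuous_at_imp_continuous_on ballI) (auto intro: schwartz_isCont)
  then have G_cont: "isCont G x" for x by (simp add: continuous_on_eq_continuous_at)
  have G_int: "integrable lborel G"
    unfolding G_def by (intro Bochner_Integration.integrable_diff integrable_mult_right cos_transform_integrable[OF u]
        cos_transform_integrable[OF u'])
  have "integral\<^sup>L lborel G = 0"
  proof (rule integral_eq_0_if_line_integrals_eq_0[OF G_int v(1)])
    fix x
    show "(\<integral>t. G (x + t *\<^sub>R v) \<partial>lborel) = 0"
    proof (rule integral_derivative_eq_0)
      show "((\<lambda>t. w (x + t *\<^sub>R v)) has_vector_derivative G (x + t *\<^sub>R v)) (at t)" for t
      proof -
        have "((\<lambda>t. u (x + t *\<^sub>R v)) has_real_derivative partial_deriv k u (x + t *\<^sub>R v)) (at t)"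
          unfolding v_def by (rule has_real_derivative_axis_line[OF u])
        moreover have "((\<lambda>t. cos (\<xi> \<bullet> x + t * \<xi> $ k + \<theta>)) has_real_derivative
            - sin (\<xi> \<bullet> x + t * \<xi> $ k + \<theta>) * \<xi> $ k) (at t)"
          by (auto intro!: derivative_eq_intros)
        ultimately have "((\<lambda>t. u (x + t *\<^sub>R v) * cos (\<xi> \<bullet> x + t * \<xi> $ k + \<theta>)) has_real_derivative
            partial_deriv k u (x + t *\<^sub>R v) * cos (\<xi> \<bullet> x + t * \<xi> $ k + \<theta>)
            + - sin (\<xi> \<bullet> x + t * \<xi> $ k + \<theta>) * \<xi> $ k * u (x + t *\<^sub>R v)) (at t)"
          by (rule DERIV_mult)
        moreover have "cos (\<xi> \<bullet> x + t * \<xi> $ k + (\<theta> - pi / 2)) = sin (\<xi> \<bullet> x + t * \<xi> $ k + \<theta>)"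
          using cos_diff[of "\<xi> \<bullet> x + t * \<xi> $ k + \<theta>" "pi / 2"] by (simp add: add_diff_eq)
        ultimately show ?thesis
          unfolding has_real_derivative_iff_has_vector_derivative w_def G_def
          by (simp add: inner_simps v(2) mult_ac)
      qed
      show "isCont (\<lambda>t. G (x + t *\<^sub>R v)) t" for t
        using isCont_o2[OF _ G_cont, of t "\<lambda>t. x + t *\<^sub>R v"] by simp
      show "integrable lborel (\<lambda>t. G (x + t *\<^sub>R v))"
        using G_int G_bound by (intro integrable_line_if_decay v) auto
      show "((\<lambda>t. w (x + t *\<^sub>R v)) \<longlongrightarrow> 0) at_top" "((\<lambda>t. w (x + t *\<^sub>R v)) \<longlongrightarrow> 0) at_bot"
        using w by (intro line_tendsto_0_if_decay v at_top_le_at_infinity at_bot_le_at_infinity; blast)+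
    qed
  qed
  also have "integral\<^sup>L lborel G
      = cos_transform (partial_deriv k u) \<xi> \<theta> - \<xi> $ k * cos_transform u \<xi> (\<theta> - pi / 2)"
    unfolding G_def cos_transform_def integral_mult_right_zero[symmetric]
    by (intro Bochner_Integration.integral_diff integrable_mult_right cos_transform_integrable[OF u]
        cos_transform_integrable[OF u'])
  finally show ?thesis by simp
qed

text \<open>Two shifts of the phase by a quarter period amount to a change of sign.\<close>

lemma cos_transform_partial_deriv2:
  assumes "u \<in> schwartz UNIV"
  shows "cos_transform (partial_deriv k (partial_deriv l u)) \<xi> \<theta>
    = - (\<xi> $ k * \<xi> $ l * cos_transform u \<xi> \<theta>)"
proof -
  have "cos (\<xi> \<bullet> x + (\<theta> - pi / 2 - pi / 2)) = - cos (\<xi> \<bullet> x + \<theta>)" for x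
    by (simp add: cos_add cos_diff sin_diff)
  then have "cos_transform u \<xi> (\<theta> - pi / 2 - pi / 2) = - cos_transform u \<xi> \<theta>"
    unfolding cos_transform_def by simp
  then show ?thesis
    using assms by (simp add: cos_transform_partial_deriv schwartz_partial_deriv)
qed

section \<open>Contraction of tensor coefficients with four vectors\<close>

definition tensor_form ::
    "('n \<Rightarrow> 'n \<Rightarrow> 'n \<Rightarrow> 'n \<Rightarrow> real) \<Rightarrow> real^'n::finite \<Rightarrow> real^'n \<Rightarrow> real^'n \<Rightarrow> real^'n \<Rightarrow> real"
  where "tensor_form T a b c d =
    (\<Sum>i\<in>UNIV. \<Sum>j\<in>UNIV. \<Sum>k\<in>UNIV. \<Sum>l\<in>UNIV. T i j k l * a $ i * b $ j * c $ k * d $ l)"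

lemma tensor_form_linear: "linear (\<lambda>a. tensor_form T a b c d)"
  by (rule linearI) (simp_all add: tensor_form_def algebra_simps sum.distrib sum_distrib_left)

lemma sum_UNIV_swap_pairs:
  fixes F :: "'n::finite \<Rightarrow> 'n \<Rightarrow> 'n \<Rightarrow> 'n \<Rightarrow> real"
  shows "(\<Sum>i\<in>UNIV. \<Sum>j\<in>UNIV. \<Sum>k\<in>UNIV. \<Sum>l\<in>UNIV. F i j k l)
    = (\<Sum>i\<in>UNIV. \<Sum>j\<in>UNIV. \<Sum>k\<in>UNIV. \<Sum>l\<in>UNIV. F k l i j)"
  unfolding sum.cartesian_product
  by (rule sum.reindex_bij_witness[where i = "\<lambda>(i, j, k, l). (k, l, i, j)" and j = "\<lambda>(i, j, k, l). (k, l, i, j)"]) auto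

lemma tensor_form_flip:
  assumes "\<And>i j k l. T i j k l = T j i k l"
  shows "tensor_form T a b c d = tensor_form T b a c d"
  unfolding tensor_form_def
  by (subst sum.swap) (intro sum.cong refl, subst assms, simp add: mult_ac)

lemma tensor_form_swap:
  assumes "\<And>i j k l. T i j k l = T k l i j"
  shows "tensor_form T a b c d = tensor_form T c d a b"
  unfolding tensor_form_def
  by (subst sum_UNIV_swap_pairs) (intro sum.cong refl, subst assms, simp add: mult_ac)

lemma tensor_form_scale:
  "tensor_form T (r *\<^sub>R a) b (s *\<^sub>R c) d = r * s * tensor_form T a b c d"
  "tensor_form T a (r *\<^sub>R b) c (s *\<^sub>R d) = r * s * tensor_form T a b c d"
  by (simp_all add: tensor_form_def sum_distrib_left mult_ac)

lemma tensor_form_axis: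
  "tensor_form T (axis i 1) (axis j 1) (axis k 1) (axis l 1) = T i j k l"
proof -
  have "(\<Sum>i\<in>UNIV. f i * axis k 1 $ i) = f k" for f :: "'a \<Rightarrow> real" and k
    using sum_axis[of k f] by (simp add: mult.commute)
  then show ?thesis
    by (simp add: tensor_form_def flip: sum_distrib_right)
qed

lemma sum_Basis_cart:
  fixes f :: "real^'n \<Rightarrow> real"
  shows "(\<Sum>b\<in>Basis. f b) = (\<Sum>k\<in>UNIV. f (axis k 1))"
proof -
  have "Basis = range (\<lambda>k::'n. axis k (1::real))" by (auto simp: Basis_vec_def)
  moreover have "inj (\<lambda>k::'n. axis k (1::real))" by (auto simp: inj_def axis_eq_axis)
  ultimately show ?thesis using sum.reindex[of "\<lambda>k. axis k 1" UNIV f] by simp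
qed

section \<open>The kernel of the transform\<close>

lemma schwartz_component:
  fixes f :: "real^'n \<Rightarrow> real^'n^'n^'n^'n"
  assumes "f \<in> schwartz E"
  shows "(\<lambda>x. f x $ i $ j $ k $ l) \<in> schwartz UNIV"
  by (intro schwartz_nth[where E = UNIV] schwartz_nth[OF assms])

lemma schwartz_tensor_form:
  assumes "\<And>i j k l. (\<lambda>x. T x i j k l) \<in> schwartz UNIV"
  shows "(\<lambda>x. tensor_form (T x) a b c d) \<in> schwartz UNIV"
  unfolding tensor_form_def by (intro schwartz_sum schwartz_mult_right assms)

text \<open>For fixed vectors the contraction is a fixed linear combination of the coefficients.
  Taking the coefficients as a function of the indices lets \<open>tensor_form\<close> apply both to
  the values of \<open>f\<close> and to their transforms.\<close>

lemma cos_transform_tensor_form: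
  assumes "\<And>i j k l. (\<lambda>x. T x i j k l) \<in> schwartz UNIV"
  shows "cos_transform (\<lambda>x. tensor_form (T x) a b c d) \<xi> \<theta>
    = tensor_form (\<lambda>i j k l. cos_transform (\<lambda>x. T x i j k l) \<xi> \<theta>) a b c d"
  unfolding tensor_form_def
  by (simp add: cos_transform_sum cos_transform_mult_right schwartz_sum schwartz_mult_right assms)

lemma X2_eq_tensor_form:
  "X2 f v q x = (\<integral>t. tensor_form (\<lambda>i j k l. f (x + t *\<^sub>R v) $ i $ j $ k $ l) v q v q \<partial>lborel)"
  by (simp add: X2_def tensor_form_def)

text \<open>Fourier uniqueness reduces each component to its cosine transforms at nonzero
  frequencies; there \<open>elastic_form_eq_0\<close> applies, and evaluation at axis vectors reads
  off the component.\<close>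

lemma common_kernel_eq_0:
  fixes f :: "real^'n \<Rightarrow> real^'n^'n^'n^'n"
  assumes H: "f \<in> ker_H_adj" and K: "f \<in> ker_K_adj" and X: "f \<in> ker_X2"
  shows "f x $ i $ j $ k $ l = 0"
proof -
  have f: "f \<in> schwartz elastic_tensors" using X by (simp add: ker_X2_def)
  note comp = schwartz_component[OF f]
  have el: "f y $ i $ j $ k $ l = f y $ j $ i $ k $ l" "f y $ i $ j $ k $ l = f y $ k $ l $ i $ j" for y i j k l
    using f unfolding schwartz_def elastic_tensors_def by blast+
  have "cos_transform (\<lambda>x. f x $ i $ j $ k $ l) \<xi> \<theta> = 0" if \<xi>: "\<xi> \<noteq> 0" for \<xi> \<theta>
  proof -
    define T where "T \<theta> i j k l = cos_transform (\<lambda>x. f x $ i $ j $ k $ l) \<xi> \<theta>" for \<theta> i j k l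
    define s where "s = inverse (norm \<xi>)"
    define e where "e = s *\<^sub>R \<xi>"
    define A where "A = tensor_form (T \<theta>)"
    have Tsym: "T \<theta> i j k l = T \<theta> j i k l" "T \<theta> i j k l = T \<theta> k l i j" for \<theta> i j k l
      unfolding T_def using el by simp_all
    have flip: "A a b c d = A b a c d" for a b c d
      unfolding A_def by (rule tensor_form_flip) (rule Tsym)
    have swap: "A a b c d = A c d a b" for a b c d
      unfolding A_def by (rule tensor_form_swap) (rule Tsym)
    have s: "s \<noteq> 0" using \<xi> by (simp add: s_def)
    have e: "norm e = 1" using \<xi> by (simp add: e_def s_def)
    have TH: "(\<Sum>k\<in>UNIV. \<Sum>l\<in>UNIV. \<xi> $ k * \<xi> $ l * T \<theta> i j k l) = 0" for i j
    proof -
      have "(\<lambda>x. \<Sum>k\<in>UNIV. \<Sum>l\<in>UNIV. partial_deriv k (partial_deriv l (\<lambda>y. f y $ i $ j $ k $ l)) x) = (\<lambda>x. 0)"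
        using H unfolding ker_H_adj_def H_adj_def by (auto simp: fun_eq_iff vec_eq_iff)
      then have "cos_transform (\<lambda>x. \<Sum>k\<in>UNIV. \<Sum>l\<in>UNIV. partial_deriv k (partial_deriv l (\<lambda>y. f y $ i $ j $ k $ l)) x) \<xi> \<theta> = 0"
        by simp
      also have "cos_transform (\<lambda>x. \<Sum>k\<in>UNIV. \<Sum>l\<in>UNIV. partial_deriv k (partial_deriv l (\<lambda>y. f y $ i $ j $ k $ l)) x) \<xi> \<theta>
          = (\<Sum>k\<in>UNIV. \<Sum>l\<in>UNIV. - (\<xi> $ k * \<xi> $ l * T \<theta> i j k l))"
        by (simp add: cos_transform_sum schwartz_sum comp schwartz_partial_deriv[OF comp]
            schwartz_partial_deriv[OF schwartz_partial_deriv[OF comp]] cos_transform_partial_deriv2 T_def)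
      finally show ?thesis by (simp add: sum_negf)
    qed
    have TK: "(\<Sum>j\<in>UNIV. \<Sum>k\<in>UNIV. \<xi> $ j * T \<theta> i j k k) = 0" for i
    proof -
      have "(\<lambda>x. \<Sum>j\<in>UNIV. \<Sum>k\<in>UNIV. partial_deriv j (\<lambda>y. f y $ i $ j $ k $ k) x) = (\<lambda>x. 0)"
        using K unfolding ker_K_adj_def K_adj_def by (auto simp: fun_eq_iff vec_eq_iff)
      \<comment> \<open>The phase \<open>\<theta> + pi / 2\<close> compensates the shift caused by
        the single derivative, so that the result concerns \<open>T \<theta>\<close>.\<close>
      then have "cos_transform (\<lambda>x. \<Sum>j\<in>UNIV. \<Sum>k\<in>UNIV. partial_deriv j (\<lambda>y. f y $ i $ j $ k $ k) x) \<xi> (\<theta> + pi / 2) = 0"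
        by simp
      then show ?thesis
        by (simp add: cos_transform_sum schwartz_sum schwartz_partial_deriv[OF comp] comp
            cos_transform_partial_deriv T_def)
    qed
    have X0: "A v q v q = 0" if v: "norm v = 1" "v \<bullet> e = 0" and q: "q \<in> Q_set v" for v q
    proof -
      have "cos_transform (\<lambda>x. tensor_form (\<lambda>i j k l. f x $ i $ j $ k $ l) v q v q) \<xi> \<theta> = 0"
      proof (rule cos_transform_slice[OF _ v(1)])
        show "v \<bullet> \<xi> = 0" using v s by (simp add: e_def)
        show "(\<integral>t. tensor_form (\<lambda>i j k l. f (x + t *\<^sub>R v) $ i $ j $ k $ l) v q v q \<partial>lborel) = 0" for x
          using X v q unfolding ker_X2_def X2_eq_tensor_form by (simp add: dist_norm)
      qed (intro schwartz_tensor_form comp)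
      then show ?thesis unfolding A_def T_def by (simp add: cos_transform_tensor_form comp)
    qed
    \<comment> \<open>The line integrals are only known for unit directions; homogeneity in the two
      slots of \<open>v\<close> extends the conclusion to every nonzero \<open>v\<close>.\<close>
    have X1: "A v q v q = 0" if v: "v \<bullet> e = 0" "v \<noteq> 0" and q: "q \<in> Q_set (v /\<^sub>R norm v)" for v q
    proof -
      have "A (v /\<^sub>R norm v) q (v /\<^sub>R norm v) q = 0" by (rule X0) (use v q in auto)
      then show ?thesis using v(2) by (simp add: A_def tensor_form_scale)
    qed
    have A0: "A a b c d = 0" if "a = 0" for a b c d
      unfolding A_def that by (rule linear_0[OF tensor_form_linear])
    have "A (axis i 1) (axis j 1) (axis k 1) (axis l 1) = 0"
    proof (rule elastic_form_eq_0[where A = A and e = e, OF _ flip swap e])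
      show "linear (\<lambda>a. A a b c d)" for b c d
        unfolding A_def by (rule tensor_form_linear)
      show "A a b e e = 0" for a b
      proof -
        have "A a b e e = (\<Sum>i\<in>UNIV. \<Sum>j\<in>UNIV. (s * s * a $ i * b $ j) *
            (\<Sum>k\<in>UNIV. \<Sum>l\<in>UNIV. \<xi> $ k * \<xi> $ l * T \<theta> i j k l))"
          unfolding A_def tensor_form_def e_def sum_distrib_left
          by (intro sum.cong refl) simp
        then show ?thesis by (simp add: TH)
      qed
      show "(\<Sum>b\<in>Basis. A a e b b) = 0" for a
      proof -
        have pick: "(\<Sum>i\<in>UNIV. g i * axis k 1 $ i) = g k" for g :: "'n \<Rightarrow> real" and k
          using sum_axis[of k g] by (simp add: mult.commute)
        have "A a e (axis k 1) (axis k 1) = (\<Sum>i\<in>UNIV. \<Sum>j\<in>UNIV. T \<theta> i j k k * a $ i * e $ j)" for k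
          unfolding A_def tensor_form_def by (simp add: pick flip: sum_distrib_right)
        then have "(\<Sum>b\<in>Basis. A a e b b) = (\<Sum>k\<in>UNIV. \<Sum>i\<in>UNIV. \<Sum>j\<in>UNIV. T \<theta> i j k k * a $ i * e $ j)"
          by (simp add: sum_Basis_cart)
        also have "\<dots> = (\<Sum>i\<in>UNIV. \<Sum>k\<in>UNIV. \<Sum>j\<in>UNIV. T \<theta> i j k k * a $ i * e $ j)"
          by (rule sum.swap)
        also have "\<dots> = (\<Sum>i\<in>UNIV. \<Sum>j\<in>UNIV. \<Sum>k\<in>UNIV. T \<theta> i j k k * a $ i * e $ j)"
          by (intro sum.cong refl sum.swap)
        also have "\<dots> = (\<Sum>i\<in>UNIV. (a $ i * s) * (\<Sum>j\<in>UNIV. \<Sum>k\<in>UNIV. \<xi> $ j * T \<theta> i j k k))"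
          unfolding e_def sum_distrib_left by (intro sum.cong refl) simp
        finally show ?thesis by (simp add: TK)
      qed
      show "A v v v v = 0" if "v \<bullet> e = 0" for v
      proof (cases "v = 0")
        case False
        then have "v \<in> Q_set (v /\<^sub>R norm v)"
          by (auto simp: Q_set_def span_singleton intro!: image_eqI[of _ _ "norm v"])
        then show ?thesis using X1 that False by simp
      qed (simp add: A0)
      show "A v q v q = 0" if "v \<bullet> e = 0" "v \<bullet> q = 0" for v q
      proof (cases "v = 0")
        case False
        have "q \<in> Q_set (v /\<^sub>R norm v)"
          using that by (simp add: Q_set_def orthogonal_comp_def orthogonal_def)
        then show ?thesis using X1 that False by simp
      qed (simp add: A0)
    qed
    then show ?thesis unfolding A_def tensor_form_axis T_def .
  qed
  \<comment> \<open>With exponent 0 the decay estimate is plain boundedness, the form that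
    \<open>fourier_unique\<close> takes.\<close>
  moreover obtain C where "\<And>x. \<bar>f x $ i $ j $ k $ l\<bar> \<le> C / (1 + (norm x)\<^sup>2) ^ 0"
    using schwartz_decay[OF comp[of i j k l], where m = 0] by (metis real_norm_def)
  moreover have "continuous_on UNIV (\<lambda>x. f x $ i $ j $ k $ l)"
    by (intro continuous_at_imp_continuous_on ballI schwartz_isCont[OF comp])
  ultimately show ?thesis
    by (intro fourier_unique[OF schwartz_integrable[OF comp[of i j k l]], where B = C])
      (simp_all add: cos_transform_def)
qed

section \<open>The images of the two differential operators\<close>

lemma ker_X2_add:
  assumes "f \<in> ker_X2" "g \<in> ker_X2"
  shows "(\<lambda>x. f x + g x) \<in> ker_X2"
proof -
  have f: "f \<in> schwartz elastic_tensors" and g: "g \<in> schwartz elastic_tensors"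
    using assms by (auto simp: ker_X2_def)
  have "X2 (\<lambda>x. f x + g x) v q x = X2 f v q x + X2 g v q x" if "norm v = 1" for v q x
  proof -
    have "tensor_form (\<lambda>i j k l. (f y + g y) $ i $ j $ k $ l) v q v q
        = tensor_form (\<lambda>i j k l. f y $ i $ j $ k $ l) v q v q
        + tensor_form (\<lambda>i j k l. g y $ i $ j $ k $ l) v q v q" for y
      by (simp add: tensor_form_def algebra_simps sum.distrib)
    \<comment> \<open>Splitting the integral relies on both contractions being integrable along the
      line, which the Schwartz decay ensures.\<close>
    then show ?thesis
      unfolding X2_eq_tensor_form
      using Bochner_Integration.integral_add[OF
          schwartz_integrable_line[OF schwartz_tensor_form[OF schwartz_component[OF f]] that]
          schwartz_integrable_line[OF schwartz_tensor_form[OF schwartz_component[OF g]] that]]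
      by (simp only:)
  qed
  moreover have "(\<lambda>x. f x + g x) \<in> schwartz elastic_tensors"
    using schwartz_add[OF f g] f g unfolding schwartz_iff[of _ elastic_tensors]
    by (auto simp: elastic_tensors_def image_subset_iff)
  ultimately show ?thesis
    using assms by (auto simp: ker_X2_def)
qed

lemma partial_deriv_sum:
  assumes "\<And>s. s \<in> S \<Longrightarrow> u s \<in> schwartz UNIV"
  shows "partial_deriv i (\<lambda>x. \<Sum>s\<in>S. u s x) = (\<lambda>x. \<Sum>s\<in>S. partial_deriv i (u s) x)"
  using assms
proof (induction S rule: infinite_finite_induct)
  case (insert s S)
  then have "(\<lambda>x. \<Sum>s\<in>S. u s x) \<in> schwartz UNIV" by (intro schwartz_sum) auto
  with insert show ?case
    by (auto simp: partial_deriv_add schwartz_differentiable[where E = UNIV])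
qed auto

lemma partial_deriv_mult_right:
  fixes u :: "real^'n \<Rightarrow> real"
  assumes "u \<in> schwartz UNIV"
  shows "partial_deriv i (\<lambda>x. u x * c) = (\<lambda>x. partial_deriv i u x * c)"
  using partial_deriv_bounded_linear[OF bounded_linear_mult_left schwartz_differentiable[OF assms]]
  by auto

text \<open>The witness \<open>u\<close> may depend on \<open>v\<close> and \<open>q\<close> but not
  on the point, so every line integral of the contraction is the integral of a derivative.\<close>

lemma in_ker_X2_if_line_derivative:
  fixes f :: "real^'n \<Rightarrow> real^'n^'n^'n^'n"
  assumes f: "f \<in> schwartz elastic_tensors"
    and "\<And>v q. norm v = 1 \<Longrightarrow> q \<in> Q_set v \<Longrightarrow> \<exists>u\<in>schwartz UNIV. \<forall>y.
      tensor_form (\<lambda>i j k l. f y $ i $ j $ k $ l) v q v q = (\<Sum>i\<in>UNIV. v $ i * partial_deriv i u y)"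
  shows "f \<in> ker_X2"
proof -
  have "X2 f v q x = 0" if v: "norm v = 1" "q \<in> Q_set v" for v q x
  proof -
    obtain u where u: "u \<in> schwartz UNIV"
      "\<And>y. tensor_form (\<lambda>i j k l. f y $ i $ j $ k $ l) v q v q = (\<Sum>i\<in>UNIV. v $ i * partial_deriv i u y)"
      using assms(2)[OF v] by blast
    show ?thesis
      unfolding X2_eq_tensor_form u(2) by (rule integral_line_derivative[OF u(1) v(1)])
  qed
  with f show ?thesis by (simp add: ker_X2_def)
qed

lemma H_op_in_ker_X2:
  fixes h :: "real^'n \<Rightarrow> real^'n^'n"
  assumes h: "h \<in> schwartz sym_tensors"
  shows "H_op h \<in> ker_X2"
proof (rule in_ker_X2_if_line_derivative)
  have comp: "(\<lambda>y. h y $ k $ l) \<in> schwartz UNIV" for k l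
    by (intro schwartz_nth[where E = UNIV] schwartz_nth[OF h])
  note d1 = schwartz_partial_deriv[OF comp]
  note d2 = schwartz_partial_deriv[OF d1]
  have sym: "h y $ k $ l = h y $ l $ k" for y k l
    using h unfolding schwartz_def sym_tensors_def by auto
  have "H_op h \<in> schwartz UNIV"
    unfolding H_op_def[abs_def]
    by (intro schwartz_vec) (simp only: vec_lambda_beta, intro schwartz_mult_left schwartz_add[where E = UNIV and F = UNIV]
        d2 schwartz_scaleR)
  moreover have "H_op h x \<in> elastic_tensors" for x
  proof -
    \<comment> \<open>Exchanging the first two indices permutes the derivatives in one summand of
      \<open>H_op\<close> and the indices of \<open>h\<close> in the other.\<close>
    have "partial_deriv i (partial_deriv j (\<lambda>y. h y $ k $ l)) x
        = partial_deriv j (partial_deriv i (\<lambda>y. h y $ k $ l)) x" for i j k l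
      by (rule partial_deriv_commute[OF comp])
    then show ?thesis unfolding elastic_tensors_def H_op_def by (simp add: sym add.commute)
  qed
  ultimately show "H_op h \<in> schwartz elastic_tensors" by (auto simp: schwartz_iff[of _ elastic_tensors])
  fix v q :: "real^'n"
  define D where "D i j k l y = partial_deriv i (partial_deriv j (\<lambda>y. h y $ k $ l)) y" for i j k l y
  \<comment> \<open>The two summands of \<open>H_op\<close> differ by exchanging the index pairs, so
    they contract to the same value; \<open>u\<close> is this contraction with the outer derivative
    along \<open>v\<close> taken off.\<close>
  define u where "u = (\<lambda>y. \<Sum>j\<in>UNIV. \<Sum>k\<in>UNIV. \<Sum>l\<in>UNIV. partial_deriv j (\<lambda>y. h y $ k $ l) y * (q $ j * v $ k * q $ l))"
  have "u \<in> schwartz UNIV"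
    unfolding u_def by (intro schwartz_sum schwartz_mult_right d1)
  moreover have "tensor_form (\<lambda>i j k l. H_op h y $ i $ j $ k $ l) v q v q
      = (\<Sum>i\<in>UNIV. v $ i * partial_deriv i u y)" for y
  proof -
    have "(\<Sum>i\<in>UNIV. v $ i * partial_deriv i u y) = tensor_form (\<lambda>i j k l. D i j k l y) v q v q"
      unfolding u_def tensor_form_def D_def
      by (simp add: partial_deriv_sum partial_deriv_mult_right schwartz_sum schwartz_mult_right d1)
        (simp add: sum_distrib_left mult_ac)
    moreover have "tensor_form (\<lambda>i j k l. D k l i j y) v q v q = tensor_form (\<lambda>i j k l. D i j k l y) v q v q"
      unfolding tensor_form_def by (subst sum_UNIV_swap_pairs) (simp add: mult_ac)
    moreover have "tensor_form (\<lambda>i j k l. H_op h y $ i $ j $ k $ l) v q v q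
        = 1 / 2 * tensor_form (\<lambda>i j k l. D i j k l y) v q v q + 1 / 2 * tensor_form (\<lambda>i j k l. D k l i j y) v q v q"
      unfolding tensor_form_def H_op_def D_def
      by (simp add: sum_distrib_left sum.distrib[symmetric] algebra_simps)
    ultimately show ?thesis by simp
  qed
  ultimately show "\<exists>u\<in>schwartz UNIV. \<forall>y. tensor_form (\<lambda>i j k l. H_op h y $ i $ j $ k $ l) v q v q
      = (\<Sum>i\<in>UNIV. v $ i * partial_deriv i u y)" by blast
qed

lemma K_op_in_ker_X2:
  fixes W :: "real^'n \<Rightarrow> real^'n"
  assumes W: "W \<in> schwartz UNIV"
  shows "K_op W \<in> ker_X2"
proof (rule in_ker_X2_if_line_derivative)
  note comp = schwartz_nth[OF W]
  note d1 = schwartz_partial_deriv[OF comp]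
  have "K_op W \<in> schwartz UNIV"
    unfolding K_op_def[abs_def]
    by (intro schwartz_vec) (simp only: vec_lambda_beta, intro schwartz_mult_right schwartz_mult_left
        schwartz_add[where E = UNIV and F = UNIV] d1)
  moreover have "K_op W x \<in> elastic_tensors" for x
    unfolding elastic_tensors_def K_op_def by (simp add: kdelta_def add.commute)
  ultimately show "K_op W \<in> schwartz elastic_tensors" by (auto simp: schwartz_iff[of _ elastic_tensors])
  fix v q :: "real^'n" assume q: "q \<in> Q_set v"
  define D where "D i j y = partial_deriv i (\<lambda>y. W y $ j) y" for i j y
  define S where "S y = (\<Sum>i\<in>UNIV. \<Sum>j\<in>UNIV. (D i j y + D j i y) * v $ i * q $ j)" for y
  \<comment> \<open>Summing against a Kronecker delta leaves the factor
    \<open>v \<bullet> q\<close>, which settles the orthogonal case. The two halves of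
    \<open>K_op\<close> contribute equally after exchanging the index pairs.\<close>
  have tf: "tensor_form (\<lambda>i j k l. K_op W y $ i $ j $ k $ l) v q v q = 1 / 2 * (v \<bullet> q) * S y" for y
  proof -
    define B where "B i j k l = (D i j y + D j i y) * kdelta k l" for i j k l :: 'n
    have "(\<Sum>l\<in>UNIV. B i j k l * v $ i * q $ j * v $ k * q $ l)
        = (D i j y + D j i y) * v $ i * q $ j * (v $ k * q $ k)" for i j k
      unfolding B_def kdelta_def by (subst sum.remove[of _ k]) (auto intro!: sum.neutral)
    moreover have "(\<Sum>k\<in>UNIV. a * (v $ k * q $ k)) = a * (v \<bullet> q)" for a
      by (simp add: inner_vec_def sum_distrib_left)
    ultimately have "tensor_form B v q v q = S y * (v \<bullet> q)"
      unfolding tensor_form_def S_def by (simp add: sum_distrib_right)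
    moreover have "tensor_form (\<lambda>i j k l. B k l i j) v q v q = tensor_form B v q v q"
      unfolding tensor_form_def by (subst sum_UNIV_swap_pairs) (simp add: mult_ac)
    moreover have "tensor_form (\<lambda>i j k l. K_op W y $ i $ j $ k $ l) v q v q
        = 1 / 4 * tensor_form B v q v q + 1 / 4 * tensor_form (\<lambda>i j k l. B k l i j) v q v q"
      unfolding tensor_form_def K_op_def B_def D_def
      by (simp add: sum_distrib_left sum.distrib[symmetric] algebra_simps)
    ultimately show ?thesis by simp
  qed
  obtain c where "v \<bullet> q = 0 \<or> q = c *\<^sub>R v"
    using q by (auto simp: Q_set_def span_singleton orthogonal_comp_def orthogonal_def)
  then show "\<exists>u\<in>schwartz UNIV. \<forall>y. tensor_form (\<lambda>i j k l. K_op W y $ i $ j $ k $ l) v q v q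
      = (\<Sum>i\<in>UNIV. v $ i * partial_deriv i u y)"
  proof
    assume "v \<bullet> q = 0"
    then show ?thesis by (intro bexI[of _ "\<lambda>x. 0"]) (auto simp: tf zero_in_schwartz)
  next
    assume q: "q = c *\<^sub>R v"
    \<comment> \<open>For \<open>q = c *\<^sub>R v\<close> both halves of \<open>S y\<close> equal
      \<open>c * P\<close>, which cancels the \<open>1 / 2\<close> and leaves the factor
      \<open>(v \<bullet> q) * c\<close>.\<close>
    define r where "r = (v \<bullet> q) * c"
    define u where "u = (\<lambda>y. \<Sum>j\<in>UNIV. W y $ j * (r * v $ j))"
    have "u \<in> schwartz UNIV"
      unfolding u_def by (intro schwartz_sum schwartz_mult_right comp)
    moreover have "1 / 2 * (v \<bullet> q) * S y = (\<Sum>i\<in>UNIV. v $ i * partial_deriv i u y)" for y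
    proof -
      define P where "P = (\<Sum>i\<in>UNIV. \<Sum>j\<in>UNIV. D i j y * v $ i * v $ j)"
      have P': "(\<Sum>i\<in>UNIV. \<Sum>j\<in>UNIV. D j i y * v $ i * v $ j) = P"
        unfolding P_def by (subst sum.swap) (simp add: mult_ac)
      have "S y = c * (P + (\<Sum>i\<in>UNIV. \<Sum>j\<in>UNIV. D j i y * v $ i * v $ j))"
        unfolding S_def P_def q
        by (simp add: sum_distrib_left sum.distrib[symmetric] algebra_simps)
      then have "1 / 2 * (v \<bullet> q) * S y = r * P"
        unfolding P' by (simp add: r_def)
      also have "\<dots> = (\<Sum>i\<in>UNIV. v $ i * partial_deriv i u y)"
        unfolding u_def P_def D_def
        by (simp add: partial_deriv_sum partial_deriv_mult_right schwartz_mult_right comp)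
          (simp add: sum_distrib_left mult_ac)
      finally show ?thesis .
    qed
    ultimately show ?thesis unfolding tf by blast
  qed
qed

theorem theorem2:
  shows "{(\<lambda>x. F x + G x) | F G. F \<in> im_H \<and> G \<in> im_K}
           \<subseteq> (ker_X2 :: (real^'n::finite \<Rightarrow> real^'n^'n^'n^'n) set)
       \<and> ker_H_adj \<inter> ker_K_adj \<inter> ker_X2
           = {(\<lambda>x. 0) :: real^'n::finite \<Rightarrow> real^'n^'n^'n^'n}"
proof (intro conjI subsetI equalityI)
  fix f :: "real^'n \<Rightarrow> real^'n^'n^'n^'n"
  assume "f \<in> {(\<lambda>x. F x + G x) | F G. F \<in> im_H \<and> G \<in> im_K}"
  then show "f \<in> ker_X2"
    by (auto simp: im_H_def im_K_def intro!: ker_X2_add H_op_in_ker_X2 K_op_in_ker_X2)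
next
  fix f :: "real^'n \<Rightarrow> real^'n^'n^'n^'n"
  assume "f \<in> ker_H_adj \<inter> ker_K_adj \<inter> ker_X2"
  then have "f x $ i $ j $ k $ l = 0" for x i j k l
    using common_kernel_eq_0 by blast
  then show "f \<in> {\<lambda>x. 0}" by (simp add: fun_eq_iff vec_eq_iff)
next
  fix f :: "real^'n \<Rightarrow> real^'n^'n^'n^'n"
  assume "f \<in> {\<lambda>x. 0}"
  then have f: "f = (\<lambda>x. 0)" by simp
  show "f \<in> ker_H_adj \<inter> ker_K_adj \<inter> ker_X2"
    unfolding f ker_H_adj_def ker_K_adj_def ker_X2_def H_adj_def K_adj_def X2_def
    by (simp add: zero_in_schwartz elastic_tensors_def vec_eq_iff fun_eq_iff)
qed

end
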